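(* Let $p$ be an odd prime, $q\in\mathbb{C}_p$ with $|1-q|_p<1$, $\chi$ a Dirichlet character with odd conductor $d$, and $F$ an odd positive integer that is a multiple of both $p$ and $d$. Define $$l_{p,q}(s,\chi)=\frac{[2]_q}{[2]_{q^F}}\sum_{\substack{a=1\\ p\nmid a}}^F(-1)^a\chi(a)q^a\langle a\rangle^{-s}\sum_{k=0}^\infty\binom{-s}{k}\left(\frac Fa\right)^{k}E_{k,q^F}.$$ Then: (a) $l_{p,q}(s,\chi)$ is analytic in $D=\{s\in\mathbb{C}_p: |s|_p<p^{1-\frac1{p-1}}\}$; (b) for every positive integer $n$, $l_{p,q}(-n,\chi)=E_{n,\chi_n,q}-p^n\chi_n(p)\frac{[2]_q}{[2]_{q^p}}E_{n,\chi_n,q^p}$; (c) for every positive integer $n$, $l_{p,q}(-n,\chi)=\int_{X^*}\chi_n(x)x^n\,d\mu_{-q}(x)$.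
   Context: $\mathbb{C}_p$ is the completion of an algebraic closure of $\mathbb{Q}_p$, $|p|_p=1/p$. Put $[x]_q=\frac{1-q^x}{1-q}$, $[x]_{-q}=\frac{1-(-q)^x}{1+q}$, so $[2]_q=1+q$. For $Q\in\mathbb{C}_p$ with $|1-Q|_p<1$, $E_{k,Q}$ is defined by $\frac{[2]_Q}{Qe^t+1}=\sum_{k\ge0}E_{k,Q}\frac{t^k}{k!}$. $\binom{-s}{k}=\frac{(-s)(-s-1)\cdots(-s-k+1)}{k!}$. $\omega$ is the Teichmüller character (conductor $p$), $\langle a\rangle=a/\omega(a)$ for $p\nmid a$, $\langle a\rangle^{-s}=\exp(-s\log_p\langle a\rangle)$, and $\chi_n$ denotes the primitive Dirichlet character associated with the product $\chi\omega^{-n}$. For a primitive Dirichlet character $\psi$ of odd conductor $f>1$, $E_{n,\psi,Q}$ is defined by $$\frac{[2]_Q\sum_{a=1}^{f}(-1)^aQ^a\psi(a)e^{ta}}{Q^fe^{ft}+1}=\sum_{n\ge0}E_{n,\psi,Q}\frac{t^n}{n!},$$ and for the trivial character ($f=1$) set $E_{n,\psi,Q}=E_{n,Q}$. Let $X=\varprojlim_N\mathbb{Z}/dp^N\mathbb{Z}$ and $X^*=\bigcup_{0<a<dp,\,(a,p)=1}(a+dp\mathbb{Z}_p)$, the set of $x\in X$ whose image in $\mathbb{Z}_p$ is a unit; $\chi_n(x)$ and $x^n$ are computed via the images of $x$ in $\mathbb{Z}/d\mathbb{Z}$, $\mathbb{Z}/p\mathbb{Z}$ and $\mathbb{Z}_p$.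 For uniformly differentiable $f:X\to\mathbb{C}_p$, $\int_X f\,d\mu_{-q}=\lim_{N\to\infty}\frac{1}{[dp^N]_{-q}}\sum_{x=0}^{dp^N-1}f(x)(-q)^x$, and $\int_{X^*}f\,d\mu_{-q}=\int_X f\cdot\mathbf{1}_{X^*}\,d\mu_{-q}$. *)

theory Defs
  imports
    "HOL-Analysis.Analysis"
    "HOL-Computational_Algebra.Computational_Algebra"
    "HOL-Number_Theory.Cong"
begin

text \<open>Fields of characteristic 0 with a non-archimedean absolute value, metrized by it.
  (The class \<^class>\<open>real_normed_field\<close> is not applicable, as p-adic fields are not real
  algebras.)\<close>

class nonarch_field = field_char_0 + metric_space +
  fixes vabs :: "'a \<Rightarrow> real"
  assumes vabs_nonneg: "0 \<le> vabs x"
    and vabs_eq_0_iff: "vabs x = 0 \<longleftrightarrow> x = 0"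
    and vabs_mult: "vabs (x * y) = vabs x * vabs y"
    and vabs_add_le: "vabs (x + y) \<le> max (vabs x) (vabs y)"
    and dist_vabs: "dist x y = vabs (x - y)"

text \<open>The type \<open>'c\<close> is (a model of) the completion of an algebraic closure of the p-adic
  numbers. In a complete field with \<open>|p| = 1/p\<close>, the closure of the rationals is the
  completion of the rationals for the p-adic absolute value; the elements algebraic over it
  have to form an algebraically closed field, and that field has to be dense.
  These conditions determine \<open>'c\<close> up to isometric isomorphism.\<close>

definition Qp :: "'c::nonarch_field set" where
  "Qp = closure (range of_rat)"

definition Qp_bar :: "'c::nonarch_field set" where
  "Qp_bar = {x. \<exists>f. f \<noteq> 0 \<and> (\<forall>i. coeff f i \<in> Qp) \<and> poly f x = 0}"

definition is_Cp :: "nat \<Rightarrow> 'c::nonarch_field itself \<Rightarrow> bool" where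
  "is_Cp p _ \<longleftrightarrow>
     vabs (of_nat p :: 'c) = 1 / real p \<and>
     complete (UNIV :: 'c set) \<and>
     (\<forall>f :: 'c poly. degree f > 0 \<and> (\<forall>i. coeff f i \<in> Qp_bar) \<longrightarrow> (\<exists>x\<in>Qp_bar. poly f x = 0)) \<and>
     closure (Qp_bar :: 'c set) = UNIV"

text \<open>An analytic function on an open disc is one given by a single power series converging
  on the whole disc.\<close>

definition analytic_on_disc :: "real \<Rightarrow> ('c::nonarch_field \<Rightarrow> 'c) \<Rightarrow> bool" where
  "analytic_on_disc r f \<longleftrightarrow> (\<exists>c. \<forall>s. vabs s < r \<longrightarrow> (\<lambda>n. c n * s ^ n) sums f s)"

definition padic_exp :: "'c::nonarch_field \<Rightarrow> 'c" where
  "padic_exp x = (\<Sum>n. x ^ n / fact n)"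

definition padic_log :: "'c::nonarch_field \<Rightarrow> 'c" where
  "padic_log x = (\<Sum>n. (-1) ^ n * (x - 1) ^ Suc n / of_nat (Suc n))"

text \<open>The q-number \<open>[x]\<^sub>Q\<close>, with the usual convention (its limit) at \<open>Q = 1\<close>.
  The number \<open>[x]\<close> with index \<open>-q\<close> is \<open>q_number x (- q)\<close>.\<close>

definition q_number :: "nat \<Rightarrow> 'c::nonarch_field \<Rightarrow> 'c" where
  "q_number x Q = (if Q = 1 then of_nat x else (1 - Q ^ x) / (1 - Q))"

lemma q_number_2: "q_number 2 Q = 1 + Q"
proof (cases "Q = 1")
  case False
  have "1 - Q ^ 2 = (1 + Q) * (1 - Q)" by (simp add: algebra_simps power2_eq_square)
  with False show ?thesis by (simp add: q_number_def)
qed (simp add: q_number_def)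

definition dcharacter :: "nat \<Rightarrow> (nat \<Rightarrow> 'c::nonarch_field) \<Rightarrow> bool" where
  "dcharacter m chi \<longleftrightarrow> m > 0 \<and>
     (\<forall>a. chi (a + m) = chi a) \<and>
     (\<forall>a b. chi (a * b) = chi a * chi b) \<and>
     (\<forall>a. chi a = 0 \<longleftrightarrow> \<not> coprime a m)"

text \<open>Only the values of the character at integers prime to the modulus matter in
  \<open>conductor\<close> and \<open>prim_char\<close>.\<close>

definition conductor :: "nat \<Rightarrow> (nat \<Rightarrow> 'c::nonarch_field) \<Rightarrow> nat" where
  "conductor m chi = (LEAST f. f dvd m \<and>
     (\<forall>a b. coprime a m \<and> coprime b m \<and> [a = b] (mod f) \<longrightarrow> chi a = chi b))"

definition primitive_dcharacter :: "nat \<Rightarrow> (nat \<Rightarrow> 'c::nonarch_field) \<Rightarrow> bool" where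
  "primitive_dcharacter f chi \<longleftrightarrow> dcharacter f chi \<and> conductor f chi = f"

definition prim_char :: "nat \<Rightarrow> (nat \<Rightarrow> 'c::nonarch_field) \<Rightarrow> nat \<Rightarrow> 'c" where
  "prim_char m chi = (THE \<psi>. primitive_dcharacter (conductor m chi) \<psi> \<and>
     (\<forall>a. coprime a m \<longrightarrow> \<psi> a = chi a))"

definition teichmueller :: "nat \<Rightarrow> nat \<Rightarrow> 'c::nonarch_field" where
  "teichmueller p a =
     (if p dvd a then 0 else (THE w. w ^ (p - 1) = 1 \<and> vabs (w - of_nat a) < 1))"

definition one_unit :: "nat \<Rightarrow> nat \<Rightarrow> 'c::nonarch_field" where
  "one_unit p a = of_nat a / teichmueller p a"

definition one_unit_pow :: "nat \<Rightarrow> nat \<Rightarrow> 'c::nonarch_field \<Rightarrow> 'c" where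
  "one_unit_pow p a s = padic_exp (s * padic_log (one_unit p a))"

text \<open>The product of \<open>chi\<close> (of modulus \<open>d\<close>) and \<open>\<omega>\<^sup>-\<^sup>n\<close>, as a function on the integers prime
  to its modulus \<open>lcm d p\<close>; the conductor of the product; and the primitive character
  \<open>chi\<^sub>n\<close> associated with it.\<close>

definition twist :: "nat \<Rightarrow> (nat \<Rightarrow> 'c::nonarch_field) \<Rightarrow> nat \<Rightarrow> nat \<Rightarrow> 'c" where
  "twist p chi n a = chi a * inverse (teichmueller p a) ^ n"

definition twist_conductor :: "nat \<Rightarrow> nat \<Rightarrow> (nat \<Rightarrow> 'c::nonarch_field) \<Rightarrow> nat \<Rightarrow> nat" where
  "twist_conductor p d chi n = conductor (lcm d p) (twist p chi n)"

definition twist_char :: "nat \<Rightarrow> nat \<Rightarrow> (nat \<Rightarrow> 'c::nonarch_field) \<Rightarrow> nat \<Rightarrow> nat \<Rightarrow> 'c" where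
  "twist_char p d chi n = prim_char (lcm d p) (twist p chi n)"

definition euler_q :: "nat \<Rightarrow> 'c::nonarch_field \<Rightarrow> 'c" where
  "euler_q k Q = fact k *
     fps_nth (fps_const (q_number 2 Q) / (fps_const Q * fps_exp 1 + 1)) k"

definition euler_char_q :: "nat \<Rightarrow> nat \<Rightarrow> (nat \<Rightarrow> 'c::nonarch_field) \<Rightarrow> 'c \<Rightarrow> 'c" where
  "euler_char_q n f \<psi> Q = (if f = 1 then euler_q n Q else fact n *
     fps_nth (fps_const (q_number 2 Q) *
         (\<Sum>a=1..f. fps_const ((-1) ^ a * Q ^ a * \<psi> a) * fps_exp (of_nat a))
       / (fps_const (Q ^ f) * fps_exp (of_nat f) + 1)) n)"

definition l_term :: "'c::nonarch_field \<Rightarrow> nat \<Rightarrow> nat \<Rightarrow> 'c \<Rightarrow> nat \<Rightarrow> 'c" where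
  "l_term q F a s k = ((- s) gchoose k) * (of_nat F / of_nat a) ^ k * euler_q k (q ^ F)"

definition l_pq :: "nat \<Rightarrow> 'c::nonarch_field \<Rightarrow> nat \<Rightarrow> 'c \<Rightarrow> (nat \<Rightarrow> 'c) \<Rightarrow> 'c" where
  "l_pq p q F s chi = q_number 2 q / q_number 2 (q ^ F) *
     (\<Sum>a | a \<in> {1..F} \<and> \<not> p dvd a.
        (-1) ^ a * chi a * q ^ a * one_unit_pow p a (- s) * (\<Sum>k. l_term q F a s k))"

text \<open>The inverse limit of the rings of integers modulo \<open>d p\<^sup>N\<close>: an element is the
  compatible sequence of its residues \<open>x N\<close> in \<open>{0..<d p\<^sup>N}\<close>.\<close>

definition X_lim :: "nat \<Rightarrow> nat \<Rightarrow> (nat \<Rightarrow> nat) set" where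
  "X_lim d p = {x. \<forall>N. x N < d * p ^ N \<and> [x (Suc N) = x N] (mod d * p ^ N)}"

definition X_of_nat :: "nat \<Rightarrow> nat \<Rightarrow> nat \<Rightarrow> nat \<Rightarrow> nat" where
  "X_of_nat d p a = (\<lambda>N. a mod (d * p ^ N))"

definition X_star :: "nat \<Rightarrow> nat \<Rightarrow> (nat \<Rightarrow> nat) set" where
  "X_star d p = (\<Union>a\<in>{a. 0 < a \<and> a < d * p \<and> coprime a p}. {x \<in> X_lim d p. x 1 = a})"

text \<open>The image in the p-adic integers, regarded inside \<open>'c\<close>.\<close>

definition X_to_Zp :: "(nat \<Rightarrow> nat) \<Rightarrow> 'c::nonarch_field" where
  "X_to_Zp x = lim (\<lambda>N. of_nat (x N))"

text \<open>The integral over \<open>X\<close> exists and equals \<open>I\<close>.\<close>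

definition has_integral_X ::
    "nat \<Rightarrow> nat \<Rightarrow> 'c::nonarch_field \<Rightarrow> ((nat \<Rightarrow> nat) \<Rightarrow> 'c) \<Rightarrow> 'c \<Rightarrow> bool" where
  "has_integral_X d p q f I \<longleftrightarrow>
     (\<lambda>N. 1 / q_number (d * p ^ N) (- q) *
        (\<Sum>x<d * p ^ N. f (X_of_nat d p x) * (- q) ^ x)) \<longlonglongrightarrow> I"

definition has_integral_X_star ::
    "nat \<Rightarrow> nat \<Rightarrow> 'c::nonarch_field \<Rightarrow> ((nat \<Rightarrow> nat) \<Rightarrow> 'c) \<Rightarrow> 'c \<Rightarrow> bool" where
  "has_integral_X_star d p q f I \<longleftrightarrow>
     has_integral_X d p q (\<lambda>x. if x \<in> X_star d p then f x else 0) I"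

end

theory Submission
  imports Defs "HOL-Number_Theory.Number_Theory"
begin

text \<open>
  Every estimate is ultrametric: \<open>|1/k!| \<le> \<theta>\<^sup>k\<close> with \<open>\<theta> = p\<^bsup>1/(p-1)\<^esup>\<close>, and the \<open>q\<close>-Euler numbers
  are integral, so both factors of each summand of \<open>l\<^bsub>p,q\<^esub>\<close> are power series in \<open>s\<close> converging for
  \<open>|s| < p/\<theta>\<close>, where series may be rearranged as soon as their terms tend to 0.

  For (b) and (c) put \<open>Y = -q e\<^sup>t\<close>. For a function \<open>g\<close> of odd period \<open>P\<close> the series
  \<open>(\<Sum>a=1..M. g(a) Y\<^sup>a) / (1 - Y\<^sup>M)\<close> is the same for all odd multiples \<open>M\<close> of \<open>P\<close>. Since \<open>\<chi>\<close> is primitive,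
  \<open>\<chi>\<^sub>n\<close> and \<open>\<chi>\<omega>\<^sup>-\<^sup>n\<close> agree at all integers prime to \<open>p\<close>, and \<open>l\<^bsub>p,q\<^esub>(-n,\<chi>)\<close> is \<open>n!\<close> times the
  \<open>n\<close>-th coefficient of \<open>1 + q\<close> times this series for \<open>g = \<chi>\<^sub>n\<close> off the multiples of \<open>p\<close> and \<open>M = F\<close>.
  Splitting off the multiples of \<open>p\<close> gives (b). With \<open>M = d p\<^sup>N\<close> instead, the coefficient differs from
  the \<open>N\<close>-th Riemann sum by terms divisible by \<open>M\<close>, which gives (c).
\<close>

subsection \<open>Series over ultrametric fields\<close>

lemma vabs_0 [simp]: "vabs (0::'c::nonarch_field) = 0"
  by (simp add: vabs_eq_0_iff)

lemma vabs_le_0_iff [simp]: "vabs (x::'c::nonarch_field) \<le> 0 \<longleftrightarrow> x = 0"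
  using vabs_nonneg[of x] vabs_eq_0_iff[of x] by linarith

lemma vabs_1 [simp]: "vabs (1::'c::nonarch_field) = 1"
  using vabs_mult[of "1::'c" 1] vabs_eq_0_iff[of "1::'c"] by simp

lemma vabs_minus [simp]: "vabs (- x :: 'c::nonarch_field) = vabs x"
proof -
  have "vabs (- 1 :: 'c) ^ 2 = 1"
    using vabs_mult[of "-1::'c" "-1"] by (simp add: power2_eq_square)
  then have "vabs (- 1 :: 'c) = 1"
    using vabs_nonneg[of "-1::'c"] by (simp add: power2_eq_1_iff)
  then show ?thesis
    using vabs_mult[of "-1" x] by simp
qed

lemma vabs_diff_commute: "vabs (x - y :: 'c::nonarch_field) = vabs (y - x)"
  using vabs_minus[of "x - y"] by simp

lemma vabs_diff_le: "vabs (x - y :: 'c::nonarch_field) \<le> max (vabs x) (vabs y)"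
  using vabs_add_le[of x "- y"] by simp

lemma vabs_power: "vabs (x ^ n :: 'c::nonarch_field) = vabs x ^ n"
  by (induction n) (simp_all add: vabs_mult)

lemma vabs_inverse: "vabs (inverse x :: 'c::nonarch_field) = inverse (vabs x)"
proof (cases "x = 0")
  case False
  then have "vabs x * vabs (inverse x) = 1"
    by (simp flip: vabs_mult)
  then show ?thesis
    by (metis inverse_unique)
qed simp

lemma vabs_divide: "vabs (x / y :: 'c::nonarch_field) = vabs x / vabs y"
  by (simp add: divide_inverse vabs_mult vabs_inverse)

lemma vabs_sum_le:
  fixes f :: "'i \<Rightarrow> 'c::nonarch_field"
  assumes "\<And>i. i \<in> A \<Longrightarrow> vabs (f i) \<le> B" and "0 \<le> B"
  shows "vabs (sum f A) \<le> B"
  using assms(1)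
proof (induction A rule: infinite_finite_induct)
  case (insert x A)
  then show ?case
    using vabs_add_le[of "f x" "sum f A"] by fastforce
qed (use assms(2) in simp_all)

lemma vabs_of_nat_le_1: "vabs (of_nat n :: 'c::nonarch_field) \<le> 1"
proof (induction n)
  case (Suc n)
  then show ?case
    using vabs_add_le[of 1 "of_nat n :: 'c"] by simp
qed simp

text \<open>In an ultrametric triangle the two longest sides are equal. This is how elements close
  to a unit are recognised as units.\<close>

lemma vabs_eq_of_diff_less:
  fixes x y :: "'c::nonarch_field"
  assumes "vabs (x - y) < vabs y"
  shows "vabs x = vabs y"
proof (rule antisym)
  show "vabs x \<le> vabs y"
    using vabs_add_le[of "x - y" y] assms by simp
  show "vabs y \<le> vabs x"
    using vabs_diff_le[of x "x - y"] assms by auto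
qed

lemma vabs_sum_less:
  fixes f :: "'i \<Rightarrow> 'c::nonarch_field"
  assumes "\<And>i. i \<in> A \<Longrightarrow> vabs (f i) < e" and "0 < e"
  shows "vabs (sum f A) < e"
  using assms(1)
proof (induction A rule: infinite_finite_induct)
  case (insert x A)
  then show ?case
    using vabs_add_le[of "f x" "sum f A"] by fastforce
qed (use assms(2) in simp_all)

section \<open>Limits, series and their rearrangement\<close>

lemma tendsto_iff_vabs:
  fixes f :: "'i \<Rightarrow> 'c::nonarch_field"
  shows "(f \<longlongrightarrow> l) F \<longleftrightarrow> (\<forall>e>0. \<forall>\<^sub>F x in F. vabs (f x - l) < e)"
  by (simp add: tendsto_iff dist_vabs)

lemma nhds_vabs:
  "(\<forall>\<^sub>F x in nhds (a::'c::nonarch_field). vabs (x - a) < e)" if "e > 0"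
  using that unfolding eventually_nhds_metric by (auto simp: dist_vabs)

text \<open>Continuity of addition, and of multiplication below, makes the general rules for limits
  of sums, differences, products and powers available.\<close>

instance nonarch_field \<subseteq> topological_ab_group_add
proof
  fix a b :: 'a
  show "((\<lambda>x. fst x + snd x) \<longlongrightarrow> a + b) (nhds a \<times>\<^sub>F nhds b)"
    unfolding tendsto_iff_vabs
  proof (intro allI impI)
    fix e :: real assume "e > 0"
    have "\<forall>\<^sub>F x in nhds a \<times>\<^sub>F nhds b. vabs (fst x - a) < e \<and> vabs (snd x - b) < e"
      by (rule eventually_prodI) (use \<open>e > 0\<close> nhds_vabs in auto)
    then show "\<forall>\<^sub>F x in nhds a \<times>\<^sub>F nhds b. vabs (fst x + snd x - (a + b)) < e"
    proof eventually_elim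
      case (elim x)
      have eq: "fst x + snd x - (a + b) = (fst x - a) + (snd x - b)" by simp
      show ?case
        unfolding eq using vabs_add_le[of "fst x - a" "snd x - b"] elim by linarith
    qed
  qed
  show "(uminus \<longlongrightarrow> - a) (nhds a)"
    unfolding tendsto_iff_vabs
  proof (intro allI impI)
    fix e :: real assume "e > 0"
    have "vabs (- x - - a) = vabs (x - a)" for x
      using vabs_minus[of "x - a"] by (simp add: algebra_simps)
    with nhds_vabs[OF \<open>e > 0\<close>, of a] show "\<forall>\<^sub>F x in nhds a. vabs (- x - - a) < e" by simp
  qed
qed

instance nonarch_field \<subseteq> topological_comm_monoid_mult
proof
  fix a b :: 'a
  show "((\<lambda>x. fst x * snd x) \<longlongrightarrow> a * b) (nhds a \<times>\<^sub>F nhds b)"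
    unfolding tendsto_iff_vabs
  proof (intro allI impI)
    fix e :: real assume e: "e > 0"
    \<comment> \<open>\<open>B\<close> strictly dominates both limits and, once
      \<open>r \<le> 1\<close>, also every second factor within \<open>r\<close> of
      \<open>b\<close>. Both parts of the usual splitting of the difference of products are then
      below \<open>r * B \<le> e\<close>.\<close>
    define B where "B = 1 + vabs a + vabs b"
    have B: "B \<ge> 1" "B > vabs a" "B > vabs b"
      using vabs_nonneg[of a] vabs_nonneg[of b] by (auto simp: B_def)
    define r where "r = min 1 (e / B)"
    have r: "r > 0" "r \<le> 1" "r * B \<le> e"
      using e B by (auto simp: r_def field_simps min_def)
    have "\<forall>\<^sub>F x in nhds a \<times>\<^sub>F nhds b. vabs (fst x - a) < r \<and> vabs (snd x - b) < r"
      by (rule eventually_prodI) (use r nhds_vabs in auto)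
    then show "\<forall>\<^sub>F x in nhds a \<times>\<^sub>F nhds b. vabs (fst x * snd x - a * b) < e"
    proof eventually_elim
      case (elim x)
      have "vabs (snd x) \<le> max (vabs (snd x - b)) (vabs b)"
        using vabs_add_le[of "snd x - b" b] by simp
      then have s: "vabs (snd x) \<le> B" using elim r B by auto
      have 1: "vabs ((fst x - a) * snd x) < r * B"
        unfolding vabs_mult
      proof (cases "vabs (snd x) = 0")
        case False
        then have "vabs (fst x - a) * vabs (snd x) < r * vabs (snd x)"
          using elim vabs_nonneg[of "snd x"] by (intro mult_strict_right_mono) auto
        also have "\<dots> \<le> r * B" using s r by (intro mult_left_mono) auto
        finally show "vabs (fst x - a) * vabs (snd x) < r * B" .
      qed (use r B in auto)
      have 2: "vabs (a * (snd x - b)) < r * B"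
        using mult_strict_mono[of "vabs (snd x - b)" r "vabs a" B] elim B r vabs_nonneg
        by (auto simp: vabs_mult mult.commute)
      have "fst x * snd x - a * b = (fst x - a) * snd x + a * (snd x - b)"
        by (simp add: algebra_simps)
      then show ?case
        using vabs_add_le[of "(fst x - a) * snd x" "a * (snd x - b)"] 1 2 r(3) by auto
    qed
  qed
qed

lemma tendsto_vabs:
  fixes f :: "'i \<Rightarrow> 'c::nonarch_field"
  assumes "(f \<longlongrightarrow> l) F"
  shows "((\<lambda>x. vabs (f x)) \<longlongrightarrow> vabs l) F"
  unfolding tendsto_iff dist_real_def
proof (intro allI impI)
  fix e :: real assume "e > 0"
  then have "\<forall>\<^sub>F x in F. vabs (f x - l) < e"
    using assms tendsto_iff_vabs by blast
  then show "\<forall>\<^sub>F x in F. \<bar>vabs (f x) - vabs l\<bar> < e"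
  proof eventually_elim
    case (elim x)
    then show ?case
      using vabs_add_le[of "f x - l" l] vabs_diff_le[of "f x" "f x - l"]
        vabs_nonneg[of "f x"] vabs_nonneg[of l] \<open>e > 0\<close>
      by (auto simp: max_def split: if_splits)
  qed
qed

lemma tendsto_0_iff_vabs:
  fixes f :: "'i \<Rightarrow> 'c::nonarch_field"
  shows "(f \<longlongrightarrow> 0) F \<longleftrightarrow> ((\<lambda>x. vabs (f x)) \<longlongrightarrow> 0) F"
  unfolding tendsto_iff_vabs tendsto_iff dist_real_def by (simp add: vabs_nonneg)

lemma tendsto_0_vabs_le:
  fixes f :: "'i \<Rightarrow> 'c::nonarch_field"
  assumes "\<And>x. vabs (f x) \<le> g x" and "(g \<longlongrightarrow> 0) F"
  shows "(f \<longlongrightarrow> 0) F"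
  unfolding tendsto_0_iff_vabs
  by (rule tendsto_sandwich[OF _ _ tendsto_const assms(2)]) (simp_all add: assms vabs_nonneg)

lemma sums_cmult:
  fixes f :: "nat \<Rightarrow> 'c::nonarch_field"
  assumes "f sums l"
  shows "(\<lambda>n. c * f n) sums (c * l)"
  using assms unfolding sums_def by (auto simp flip: sum_distrib_left intro: tendsto_mult)

lemma vabs_suminf_le:
  fixes f :: "nat \<Rightarrow> 'c::nonarch_field"
  assumes "f sums l" and "\<And>n. vabs (f n) \<le> B"
  shows "vabs l \<le> B"
proof (rule LIMSEQ_le_const2)
  show "(\<lambda>n. vabs (\<Sum>i<n. f i)) \<longlonglongrightarrow> vabs l"
    using assms(1) unfolding sums_def by (rule tendsto_vabs)
  have "0 \<le> B" using assms(2)[of 0] vabs_nonneg order_trans by blast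
  then show "\<exists>N. \<forall>n\<ge>N. vabs (\<Sum>i<n. f i) \<le> B"
    using assms(2) by (auto intro!: vabs_sum_le)
qed

text \<open>A difference of partial sums is a finite sum of small terms, and the ultrametric
  inequality bounds it by the largest of them, so the partial sums form a Cauchy sequence.\<close>

lemma summable_of_null:
  fixes f :: "nat \<Rightarrow> 'c::nonarch_field"
  assumes "complete (UNIV :: 'c set)" and "f \<longlonglongrightarrow> 0"
  shows "summable f"
proof -
  have "Cauchy (\<lambda>n. \<Sum>i<n. f i)"
    unfolding Cauchy_altdef2
  proof (intro allI impI)
    fix e :: real assume e: "e > 0"
    then obtain N where N: "\<And>n. n \<ge> N \<Longrightarrow> vabs (f n) < e"
      using assms(2) unfolding tendsto_iff_vabs eventually_sequentially by auto
    have "dist (\<Sum>i<n. f i) (\<Sum>i<N. f i) < e" if "n \<ge> N" for n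
    proof -
      have "(\<Sum>i<n. f i) - (\<Sum>i<N. f i) = (\<Sum>i\<in>{N..<n}. f i)"
        using sum_diff_nat_ivl[of 0 N n f] that by (simp add: atLeast0LessThan)
      then show ?thesis
        using vabs_sum_less[of "{N..<n}" f e] N e by (simp add: dist_vabs)
    qed
    then show "\<exists>N. \<forall>n\<ge>N. dist (\<Sum>i<n. f i) (\<Sum>i<N. f i) < e" by blast
  qed
  then show ?thesis
    using assms(1) unfolding complete_def summable_def sums_def by blast
qed

lemma null_of_sums:
  fixes f :: "nat \<Rightarrow> 'c::nonarch_field"
  assumes "f sums l"
  shows "f \<longlonglongrightarrow> 0"
proof -
  have "(\<lambda>n. (\<Sum>i<Suc n. f i) - (\<Sum>i<n. f i)) \<longlonglongrightarrow> l - l"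
    using assms unfolding sums_def by (intro tendsto_diff LIMSEQ_Suc)
  then show ?thesis by simp
qed

text \<open>Each bound \<open>e\<close> fails for at most finitely many pairs, all inside a square.
  For ultrametric double series this takes the place of absolute convergence.\<close>

definition null2 :: "(nat \<Rightarrow> nat \<Rightarrow> 'c::nonarch_field) \<Rightarrow> bool" where
  "null2 u \<longleftrightarrow> (\<forall>e>0. \<exists>N. \<forall>i j. N \<le> i \<or> N \<le> j \<longrightarrow> vabs (u i j) < e)"

lemma null2_swap: "null2 u \<Longrightarrow> null2 (\<lambda>i j. u j i)"
  unfolding null2_def by blast

lemma null2_tendsto_0: "null2 u \<Longrightarrow> (\<lambda>j. u i j) \<longlonglongrightarrow> 0"
  unfolding null2_def tendsto_iff_vabs eventually_sequentially diff_0_right by blast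

text \<open>Everything outside the square with side \<open>N\<close> contributes at most
  \<open>e\<close>. The square is symmetric in the two indices, so it serves as common approximation
  of both iterated sums.\<close>

lemma null2_suminf_close:
  fixes u :: "nat \<Rightarrow> nat \<Rightarrow> 'c::nonarch_field"
  assumes c: "complete (UNIV :: 'c set)" and u: "null2 u"
    and N: "\<And>i j. N \<le> i \<or> N \<le> j \<Longrightarrow> vabs (u i j) < e" and e: "e > 0" and n: "n \<ge> N"
  shows "vabs ((\<Sum>i<n. \<Sum>j. u i j) - (\<Sum>i<N. \<Sum>j<N. u i j)) \<le> e"
proof -
  have s: "u i sums (\<Sum>j. u i j)" for i
    using summable_of_null[OF c null2_tendsto_0[OF u]] by (rule summable_sums)
  have row: "vabs ((\<Sum>j. u i j) - (\<Sum>j<N. u i j)) \<le> e" for i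
  proof -
    have "(\<lambda>j. u i (j + N)) sums ((\<Sum>j. u i j) - (\<Sum>j<N. u i j))"
    proof -
      have "(\<lambda>n. (\<Sum>j<n + N. u i j) - (\<Sum>j<N. u i j)) \<longlonglongrightarrow> (\<Sum>j. u i j) - (\<Sum>j<N. u i j)"
        using s unfolding sums_def by (intro tendsto_diff tendsto_const LIMSEQ_ignore_initial_segment)
      moreover have "(\<Sum>j<n + N. u i j) - (\<Sum>j<N. u i j) = (\<Sum>j<n. u i (j + N))" for n
        using sum_diff_nat_ivl[of 0 N "n + N" "u i"]
          sum.shift_bounds_nat_ivl[of "u i" 0 N n] by (simp add: atLeast0LessThan)
      ultimately show ?thesis by (simp add: sums_def)
    qed
    then show ?thesis
      by (rule vabs_suminf_le) (use N[of i] in \<open>simp add: less_imp_le\<close>)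
  qed
  have tail: "vabs (\<Sum>j. u i j) \<le> e" if "i \<ge> N" for i
    using s by (rule vabs_suminf_le) (use N[of i] that in \<open>simp add: less_imp_le\<close>)
  have "(\<Sum>i<n. \<Sum>j. u i j) - (\<Sum>i<N. \<Sum>j<N. u i j) =
      (\<Sum>i<N. (\<Sum>j. u i j) - (\<Sum>j<N. u i j)) + (\<Sum>i\<in>{N..<n}. \<Sum>j. u i j)"
    using sum.atLeastLessThan_concat[of 0 N n "\<lambda>i. \<Sum>j. u i j"] n
    by (simp add: atLeast0LessThan sum_subtractf algebra_simps)
  also have "vabs \<dots> \<le> max (vabs (\<Sum>i<N. (\<Sum>j. u i j) - (\<Sum>j<N. u i j)))
      (vabs (\<Sum>i\<in>{N..<n}. \<Sum>j. u i j))"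
    by (rule vabs_add_le)
  also have "\<dots> \<le> e"
    using row tail e by (auto intro!: vabs_sum_le)
  finally show ?thesis .
qed

lemma suminf_swap:
  fixes u :: "nat \<Rightarrow> nat \<Rightarrow> 'c::nonarch_field"
  assumes c: "complete (UNIV :: 'c set)" and u: "null2 u"
    and S: "(\<lambda>i. \<Sum>j. u i j) sums S"
  shows "(\<lambda>j. \<Sum>i. u i j) sums S"
  unfolding sums_def tendsto_iff_vabs eventually_sequentially
proof (intro allI impI)
  fix e :: real assume "e > 0"
  \<comment> \<open>Any \<open>r\<close> strictly below \<open>e\<close> would do: ultrametric
    errors do not add up, but the bound of \<open>null2_suminf_close\<close> is not strict.\<close>
  define r where "r = e / 2"
  have r: "r > 0" "r < e" using \<open>e > 0\<close> by (auto simp: r_def)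
  obtain N where N: "\<And>i j. N \<le> i \<or> N \<le> j \<Longrightarrow> vabs (u i j) < r"
    using u r unfolding null2_def by meson
  obtain M where M: "\<And>n. n \<ge> M \<Longrightarrow> vabs ((\<Sum>i<n. \<Sum>j. u i j) - S) < r"
    using S r unfolding sums_def tendsto_iff_vabs eventually_sequentially by meson
  have "vabs ((\<Sum>j<n. \<Sum>i. u i j) - S) < e" if n: "n \<ge> max M N" for n
  proof -
    have 1: "vabs ((\<Sum>i<n. \<Sum>j. u i j) - (\<Sum>i<N. \<Sum>j<N. u i j)) \<le> r"
      using n by (intro null2_suminf_close[OF c u N r(1)]) auto
    have 2: "vabs ((\<Sum>j<n. \<Sum>i. u i j) - (\<Sum>j<N. \<Sum>i<N. u i j)) \<le> r"
      using n N by (intro null2_suminf_close[OF c null2_swap[OF u] _ r(1)]) auto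
    have 3: "vabs ((\<Sum>i<n. \<Sum>j. u i j) - S) < r" using M n by auto
    have eq: "(\<Sum>j<n. \<Sum>i. u i j) - S =
        ((\<Sum>j<n. \<Sum>i. u i j) - (\<Sum>j<N. \<Sum>i<N. u i j)) -
        (((\<Sum>i<n. \<Sum>j. u i j) - (\<Sum>i<N. \<Sum>j<N. u i j)) - ((\<Sum>i<n. \<Sum>j. u i j) - S))"
      using sum.swap[of "\<lambda>j i. u i j" "{..<N}" "{..<N}"] by simp
    show ?thesis
      unfolding eq
      by (rule le_less_trans[OF vabs_diff_le]) (use 1 2 3 r vabs_diff_le[of
          "((\<Sum>i<n. \<Sum>j. u i j) - (\<Sum>i<N. \<Sum>j<N. u i j))" "((\<Sum>i<n. \<Sum>j. u i j) - S)"] in auto)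
  qed
  then show "\<exists>N. \<forall>n\<ge>N. vabs ((\<Sum>j<n. \<Sum>i. u i j) - S) < e" by blast
qed

lemma null_imp_bounded:
  fixes f :: "nat \<Rightarrow> 'c::nonarch_field"
  assumes "f \<longlonglongrightarrow> 0"
  obtains B where "B > 0" "\<And>n. vabs (f n) < B"
proof -
  have "Bseq (\<lambda>n. vabs (f n))"
    using assms convergentI convergent_imp_Bseq unfolding tendsto_0_iff_vabs by blast
  then obtain B where B: "B > 0" "\<And>n. norm (vabs (f n)) \<le> B"
    unfolding Bseq_def by blast
  have "vabs (f n) < B + 1" for n
    using B(2)[of n] by simp
  then show ?thesis using B(1) that[of "B + 1"] by simp
qed

text \<open>The product of the partial sums runs over a square of index pairs, the Cauchy product
  over the triangle \<open>i + j < n\<close>. In the remaining pairs one index is large, so one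
  factor is small and the other bounded; no absolute convergence is involved.\<close>

lemma Cauchy_product_sums_nonarch:
  fixes a b :: "nat \<Rightarrow> 'c::nonarch_field"
  assumes a: "a sums x" and b: "b sums y"
  shows "(\<lambda>n. \<Sum>i\<le>n. a i * b (n - i)) sums (x * y)"
proof -
  obtain A where A: "A > 0" "\<And>n. vabs (a n) < A"
    using null_imp_bounded[OF null_of_sums[OF a]] by blast
  obtain B where B: "B > 0" "\<And>n. vabs (b n) < B"
    using null_imp_bounded[OF null_of_sums[OF b]] by blast
  let ?D = "\<lambda>n. (\<Sum>i<n. a i) * (\<Sum>j<n. b j) - (\<Sum>k<n. \<Sum>i\<le>k. a i * b (k - i))"
  have "?D \<longlonglongrightarrow> 0"
    unfolding tendsto_iff_vabs eventually_sequentially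
  proof (intro allI impI)
    fix e :: real assume e: "e > 0"
    obtain M where M: "\<And>n. n \<ge> M \<Longrightarrow> vabs (a n) < e / B"
      using null_of_sums[OF a] e B unfolding tendsto_iff_vabs eventually_sequentially
      by (metis diff_zero divide_pos_pos)
    obtain N where N: "\<And>n. n \<ge> N \<Longrightarrow> vabs (b n) < e / A"
      using null_of_sums[OF b] e A unfolding tendsto_iff_vabs eventually_sequentially
      by (metis diff_zero divide_pos_pos)
    have "vabs (?D n - 0) < e" if n: "n \<ge> M + N" for n
    proof -
      have "?D n = (\<Sum>(i,j)\<in>{..<n} \<times> {..<n}. a i * b j) - (\<Sum>(i,j)\<in>{(i,j). i + j < n}. a i * b j)"
        by (simp add: sum_product sum.cartesian_product sum.triangle_reindex)
      also have "\<dots> = (\<Sum>(i,j)\<in>{..<n} \<times> {..<n} - {(i,j). i + j < n}. a i * b j)"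
        by (rule sum_diff[symmetric]) auto
      finally have eq: "?D n = (\<Sum>(i,j)\<in>{..<n} \<times> {..<n} - {(i,j). i + j < n}. a i * b j)" .
      have "vabs (a i * b j) < e" if "i + j \<ge> n" for i j
      proof -
        have "i \<ge> M \<or> j \<ge> N" using that n by linarith
        then show ?thesis
        proof
          assume "i \<ge> M"
          then have "vabs (a i) * vabs (b j) < e / B * B"
            using M[of i] B A e by (intro mult_strict_mono) (auto simp: vabs_nonneg)
          then show ?thesis using B by (simp add: vabs_mult)
        next
          assume "j \<ge> N"
          then have "vabs (a i) * vabs (b j) < A * (e / A)"
            using N[of j] B A e by (intro mult_strict_mono) (auto simp: vabs_nonneg)
          then show ?thesis using A by (simp add: vabs_mult)
        qed
      qed
      then have "vabs (case x of (i, j) \<Rightarrow> a i * b j) < e"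
        if "x \<in> {..<n} \<times> {..<n} - {(i,j). i + j < n}" for x
        using that by (cases x) auto
      then show ?thesis unfolding eq diff_zero using e by (intro vabs_sum_less)
    qed
    then show "\<exists>N. \<forall>n\<ge>N. vabs (?D n - 0) < e" by blast
  qed
  moreover have "(\<lambda>n. (\<Sum>i<n. a i) * (\<Sum>j<n. b j)) \<longlonglongrightarrow> x * y"
    using a b unfolding sums_def by (rule tendsto_mult)
  ultimately have "(\<lambda>n. (\<Sum>i<n. a i) * (\<Sum>j<n. b j) - ?D n) \<longlonglongrightarrow> x * y - 0"
    by (intro tendsto_diff)
  then show ?thesis by (simp add: sums_def)
qed

section \<open>Functions analytic on a disc\<close>

lemma analytic_on_disc_cmult:
  "analytic_on_disc r f \<Longrightarrow> analytic_on_disc r (\<lambda>s. c * f s)"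
proof -
  assume "analytic_on_disc r f"
  then obtain a where a: "\<And>s. vabs s < r \<Longrightarrow> (\<lambda>n. a n * s ^ n) sums f s"
    unfolding analytic_on_disc_def by blast
  have "(\<lambda>n. (c * a n) * s ^ n) sums (c * f s)" if "vabs s < r" for s
    using sums_cmult[OF a[OF that], of c] by (simp add: mult.assoc)
  then show ?thesis
    unfolding analytic_on_disc_def by (intro exI[of _ "\<lambda>n. c * a n"]) simp
qed

lemma analytic_on_disc_mult:
  assumes "analytic_on_disc r f" and "analytic_on_disc r g"
  shows "analytic_on_disc r (\<lambda>s. f s * g s)"
proof -
  obtain a b where
    a: "\<And>s. vabs s < r \<Longrightarrow> (\<lambda>n. a n * s ^ n) sums f s" and
    b: "\<And>s. vabs s < r \<Longrightarrow> (\<lambda>n. b n * s ^ n) sums g s"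
    using assms unfolding analytic_on_disc_def by meson
  have "(\<lambda>n. (\<Sum>i\<le>n. a i * b (n - i)) * s ^ n) sums (f s * g s)" if "vabs s < r" for s
  proof -
    have "(\<Sum>i\<le>n. a i * b (n - i)) * s ^ n = (\<Sum>i\<le>n. a i * s ^ i * (b (n - i) * s ^ (n - i)))" for n
      unfolding sum_distrib_right
      by (intro sum.cong refl) (simp add: mult_ac flip: power_add)
    then show ?thesis
      using Cauchy_product_sums_nonarch[OF a[OF that] b[OF that]] by simp
  qed
  then show ?thesis unfolding analytic_on_disc_def
    by (intro exI[of _ "\<lambda>n. \<Sum>i\<le>n. a i * b (n - i)"]) simp
qed

lemma analytic_on_disc_sum:
  assumes "\<And>i. i \<in> I \<Longrightarrow> analytic_on_disc r (f i)"
  shows "analytic_on_disc r (\<lambda>s. \<Sum>i\<in>I. f i s)"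
proof -
  obtain c where c: "\<And>i s. i \<in> I \<Longrightarrow> vabs s < r \<Longrightarrow> (\<lambda>n. c i n * s ^ n) sums f i s"
    using assms unfolding analytic_on_disc_def by metis
  have "(\<lambda>n. (\<Sum>i\<in>I. c i n) * s ^ n) sums (\<Sum>i\<in>I. f i s)" if "vabs s < r" for s
    unfolding sum_distrib_right by (intro sums_sum c that)
  then show ?thesis unfolding analytic_on_disc_def
    by (intro exI[of _ "\<lambda>n. \<Sum>i\<in>I. c i n"]) simp
qed

subsection \<open>Factorials\<close>

locale padic_field =
  fixes p :: nat and ty :: "'c::nonarch_field itself"
  assumes prime_p: "prime p" and odd_p: "odd p"
    and vabs_p: "vabs (of_nat p :: 'c) = 1 / real p"
    and complete_UNIV: "complete (UNIV :: 'c set)"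
begin

lemma p_ge_3: "p \<ge> 3"
proof -
  have "p \<noteq> 2" using odd_p by auto
  then show ?thesis using prime_ge_2_nat[OF prime_p] by simp
qed

lemma one_over_p_less_1: "1 / real p < 1"
  using p_ge_3 by simp

lemma vabs_of_int_le_1: "vabs (of_int z :: 'c) \<le> 1"
  by (cases z) (use vabs_of_nat_le_1[where 'c='c] in \<open>simp_all del: of_nat_Suc\<close>)

lemma vabs_of_nat_cong:
  assumes "[a = b] (mod p ^ k)"
  shows "vabs (of_nat a - of_nat b :: 'c) \<le> (1 / real p) ^ k"
proof -
  have "[int a = int b] (mod int (p ^ k))"
    using assms by (simp only: cong_int_iff)
  then obtain t where t: "int a - int b = int (p ^ k) * t"
    by (auto simp: cong_iff_dvd_diff)
  have "of_nat a - of_nat b = (of_int (int a - int b) :: 'c)" by simp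
  also have "\<dots> = of_nat p ^ k * of_int t" unfolding t by simp
  finally have "vabs (of_nat a - of_nat b :: 'c) = (1 / real p) ^ k * vabs (of_int t :: 'c)"
    by (simp add: vabs_mult vabs_power vabs_p)
  then show ?thesis
    using vabs_of_int_le_1[of t] by (simp add: mult_left_le)
qed

lemma vabs_of_nat_dvd:
  assumes "p ^ k dvd a"
  shows "vabs (of_nat a :: 'c) \<le> (1 / real p) ^ k"
  using vabs_of_nat_cong[of a 0 k] assms by (simp add: cong_0_iff)

text \<open>If \<open>x\<close> inverts \<open>a\<close> modulo \<open>p\<close>, then
  \<open>a * x\<close> is within \<open>1 / p\<close> of 1 and has absolute value 1. As neither
  factor exceeds 1, both have absolute value 1.\<close>

lemma vabs_of_nat_unit:
  assumes "\<not> p dvd a"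
  shows "vabs (of_nat a :: 'c) = 1"
proof -
  have "coprime a p"
    using assms prime_p by (metis coprime_commute prime_imp_coprime)
  then obtain x where x: "[a * x = 1] (mod p)"
    using cong_solve_coprime_nat by (metis One_nat_def)
  have "vabs (of_nat (a * x) - of_nat 1 :: 'c) < vabs (1 :: 'c)"
    using vabs_of_nat_cong[of "a * x" 1 1] x one_over_p_less_1 by simp
  then have 1: "vabs (of_nat (a * x) :: 'c) = 1"
    using vabs_eq_of_diff_less[of "of_nat (a * x) :: 'c" 1] by simp
  then have "1 = vabs (of_nat a :: 'c) * vabs (of_nat x :: 'c)"
    by (simp add: vabs_mult)
  also have "\<dots> \<le> vabs (of_nat a :: 'c)"
    using vabs_of_nat_le_1[of x, where 'c='c] by (simp add: mult_left_le vabs_nonneg)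
  finally show ?thesis
    using vabs_of_nat_le_1[of a, where 'c='c] by simp
qed

text \<open>The growth rate of \<open>1 / vabs (fact k)\<close>, that is, the reciprocal of the
  radius of convergence of the p-adic exponential.\<close>

definition \<theta> :: real where "\<theta> = real p powr (1 / (real p - 1))"

lemma theta_power: "\<theta> ^ (p - 1) = real p"
proof -
  have "\<theta> ^ (p - 1) = \<theta> powr (real p - 1)"
    using p_ge_3 by (subst powr_realpow[symmetric]) (auto simp: \<theta>_def of_nat_diff)
  then show ?thesis
    using p_ge_3 by (simp add: \<theta>_def powr_powr)
qed

lemma theta_ge_1: "\<theta> \<ge> 1"
  unfolding \<theta>_def using p_ge_3 by (intro ge_one_powr_ge_zero) auto

lemma theta_less_p: "\<theta> < real p"
proof -
  have "\<theta> < real p powr 1"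
    unfolding \<theta>_def using p_ge_3 by (intro powr_less_mono) auto
  then show ?thesis using p_ge_3 by simp
qed

lemma radius_eq: "real p powr (1 - 1 / (real p - 1)) = real p / \<theta>"
  using p_ge_3 by (simp add: powr_diff \<theta>_def)

text \<open>Only the multiples of \<open>p\<close> among the factors of \<open>fact k\<close>
  matter. They are \<open>p\<close> times the numbers from 1 to \<open>k div p\<close>, which gives
  Legendre's recursion.\<close>

lemma vabs_fact_div: "vabs (fact k :: 'c) = (1 / real p) ^ (k div p) * vabs (fact (k div p) :: 'c)"
proof (induction k)
  case (Suc k)
  have S: "vabs (fact (Suc n) :: 'c) = vabs (of_nat (Suc n) :: 'c) * vabs (fact n :: 'c)" for n
    by (simp add: vabs_mult del: of_nat_Suc)
  show ?case
  proof (cases "p dvd Suc k")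
    case False
    then have "Suc k div p = k div p"
      by (simp add: div_Suc dvd_eq_mod_eq_0)
    then show ?thesis
      using Suc.IH vabs_of_nat_unit[OF False] S[of k] by simp
  next
    case True
    then have d: "Suc k div p = Suc (k div p)"
      by (simp add: div_Suc dvd_eq_mod_eq_0)
    have "Suc k = p * Suc (k div p)"
      using True d by (metis dvd_mult_div_cancel)
    then have "vabs (of_nat (Suc k) :: 'c) = 1 / real p * vabs (of_nat (Suc (k div p)) :: 'c)"
      by (metis of_nat_mult vabs_mult vabs_p)
    then show ?thesis
      using Suc.IH S[of k] S[of "k div p"] d by (simp del: of_nat_Suc fact_Suc)
  qed
qed simp

text \<open>Legendre's estimate \<open>v(k!) \<le> (k - 1) / (p - 1)\<close>; the truncated subtraction covers \<open>k = 0\<close>.\<close>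

lemma vabs_fact_ge: "1 / vabs (fact k :: 'c) \<le> \<theta> ^ (k - 1)"
proof (induction k rule: less_induct)
  case (less k)
  show ?case
  proof (cases "k < p")
    case True
    then show ?thesis
      using theta_ge_1 vabs_fact_div[of k] by simp
  next
    case False
    define m where "m = k div p"
    have m: "m \<ge> 1" "m < k" "p * m \<le> k"
      using False p_ge_3 div_le_mono[of p k p] by (auto simp: m_def)
    \<comment> \<open>Exponents of \<open>\<theta>\<close>: since
      \<open>p = \<theta> ^ (p - 1)\<close>, the factor \<open>p ^ m\<close> costs
      \<open>(p - 1) * m\<close>, and the induction hypothesis another \<open>m - 1\<close>.\<close>
    have "(p - 1) * m + (m - 1) = p * m - 1"
      using m p_ge_3 by (cases p) auto
    have "1 / vabs (fact k :: 'c) = real p ^ m * (1 / vabs (fact m :: 'c))"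
      unfolding vabs_fact_div[of k] m_def[symmetric] by (simp add: power_divide)
    also have "\<dots> \<le> real p ^ m * \<theta> ^ (m - 1)"
      using less m by (intro mult_left_mono) auto
    also have "\<dots> = \<theta> ^ (p * m - 1)"
      using \<open>(p - 1) * m + (m - 1) = p * m - 1\<close>
      by (metis theta_power power_add power_mult)
    also have "\<dots> \<le> \<theta> ^ (k - 1)"
      using m theta_ge_1 by (intro power_increasing) auto
    finally show ?thesis .
  qed
qed

lemma vabs_fact_ge': "1 / vabs (fact k :: 'c) \<le> \<theta> ^ k"
  using vabs_fact_ge[of k] theta_ge_1 power_increasing[of "k - 1" k \<theta>] by simp

text \<open>As \<open>k\<close> divides \<open>fact k\<close>, the bound for factorials carries
  over. It is crude, but gives the logarithm coefficients the same growth rate as those of the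
  exponential.\<close>

lemma vabs_of_nat_ge:
  assumes "k > 0"
  shows "1 / vabs (of_nat k :: 'c) \<le> \<theta> ^ (k - 1)"
proof -
  have "vabs (fact k :: 'c) = vabs (of_nat k :: 'c) * vabs (fact (k - 1) :: 'c)"
    using assms by (metis fact_reduce vabs_mult)
  moreover have "vabs (fact (k - 1) :: 'c) \<le> 1"
    using vabs_of_nat_le_1[of "fact (k - 1)", where 'c='c] by simp
  ultimately have "vabs (fact k :: 'c) \<le> vabs (of_nat k :: 'c)"
    by (simp add: mult_left_le vabs_nonneg)
  moreover have "vabs (fact k :: 'c) > 0"
    using vabs_eq_0_iff[of "fact k :: 'c"] vabs_nonneg[of "fact k :: 'c"] by (simp add: order_less_le)
  ultimately have "1 / vabs (of_nat k :: 'c) \<le> 1 / vabs (fact k :: 'c)"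
    by (simp add: frac_le)
  then show ?thesis using vabs_fact_ge[of k] by simp
qed

lemma tendsto_ratio_power: "(\<lambda>k. (\<theta> / real p) ^ k) \<longlonglongrightarrow> 0"
  using theta_ge_1 theta_less_p by (intro LIMSEQ_power_zero) auto

lemma null2I_geometric:
  fixes u :: "nat \<Rightarrow> nat \<Rightarrow> 'c"
  assumes "\<And>i j. vabs (u i j) \<le> \<rho> ^ max i j" and "0 \<le> \<rho>" "\<rho> < 1"
  shows "null2 u"
  unfolding null2_def
proof (intro allI impI)
  fix e :: real assume "e > 0"
  then obtain N where N: "\<rho> ^ N < e"
    using assms real_arch_pow_inv by blast
  have "vabs (u i j) < e" if "N \<le> i \<or> N \<le> j" for i j
  proof -
    have "vabs (u i j) \<le> \<rho> ^ max i j" by (rule assms)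
    also have "\<dots> \<le> \<rho> ^ N" using that assms by (intro power_decreasing) auto
    finally show ?thesis using N by simp
  qed
  then show "\<exists>N. \<forall>i j. N \<le> i \<or> N \<le> j \<longrightarrow> vabs (u i j) < e" by blast
qed

subsection \<open>Exponential and logarithm\<close>

text \<open>Each factor of degree \<open>i\<close> contributes \<open>\<theta> ^ (i - 1)\<close>, so
  \<open>m\<close> factors save \<open>m\<close> powers of \<open>\<theta>\<close>. This saving
  later pays for the \<open>1 / fact m\<close> of the exponential series.\<close>

lemma vabs_fps_ln_power:
  "vabs (fps_nth (fps_ln (1::'c) ^ m) k) \<le> (if k < m then 0 else \<theta> ^ (k - m))"
proof (induction m arbitrary: k)
  case 0
  then show ?case using theta_ge_1 by (simp add: fps_one_nth)
next
  case (Suc m)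
  have L: "vabs (fps_nth (fps_ln (1::'c)) i) \<le> (if i = 0 then 0 else \<theta> ^ (i - 1))" for i
    using vabs_of_nat_ge[of i] by (simp add: fps_ln_nth vabs_divide vabs_power)
  have "vabs (fps_nth (fps_ln (1::'c)) i * fps_nth (fps_ln 1 ^ m) (k - i))
      \<le> (if k < Suc m then 0 else \<theta> ^ (k - Suc m))" if "i \<le> k" for i
  proof (cases "i = 0 \<or> k - i < m")
    case True
    then have "fps_nth (fps_ln (1::'c)) i = 0 \<or> fps_nth (fps_ln (1::'c) ^ m) (k - i) = 0"
      using Suc.IH[of "k - i"] by (auto simp: fps_ln_nth)
    then show ?thesis using theta_ge_1 by auto
  next
    case False
    have "vabs (fps_nth (fps_ln (1::'c)) i) * vabs (fps_nth (fps_ln (1::'c) ^ m) (k - i))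
       \<le> \<theta> ^ (i - 1) * \<theta> ^ (k - i - m)"
      using L[of i] Suc.IH[of "k - i"] False theta_ge_1
      by (intro mult_mono) (auto simp: vabs_nonneg)
    also have "\<dots> = \<theta> ^ (k - Suc m)"
      using False that by (auto simp flip: power_add intro!: arg_cong[of _ _ "\<lambda>n. \<theta> ^ n"])
    finally show ?thesis using False that by (auto simp: vabs_mult)
  qed
  then show ?case
    unfolding power_Suc fps_mult_nth using theta_ge_1 by (intro vabs_sum_le) auto
qed

lemma vabs_power_le: "vabs x \<le> 1 / real p \<Longrightarrow> vabs (x ^ k :: 'c) \<le> (1 / real p) ^ k"
  by (simp add: vabs_power power_mono vabs_nonneg)

lemma vabs_fps_ln_power_term:
  assumes "vabs (x::'c) \<le> 1 / real p"
  shows "vabs (fps_nth (fps_ln (1::'c) ^ m) k * x ^ k) \<le> (\<theta> / real p) ^ k"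
proof -
  have "vabs (fps_nth (fps_ln (1::'c) ^ m) k) \<le> \<theta> ^ k"
    using vabs_fps_ln_power[of m k] theta_ge_1 power_increasing[of "k - m" k \<theta>]
    by (auto split: if_splits intro: order_trans)
  then have "vabs (fps_nth (fps_ln (1::'c) ^ m) k) * vabs (x ^ k) \<le> \<theta> ^ k * (1 / real p) ^ k"
    using vabs_power_le[OF assms] theta_ge_1 by (intro mult_mono) (auto simp: vabs_nonneg)
  then show ?thesis by (simp add: vabs_mult power_divide)
qed

lemma padic_log_sums:
  assumes "vabs (x::'c) \<le> 1 / real p"
  shows "(\<lambda>k. fps_nth (fps_ln 1) k * x ^ k) sums padic_log (1 + x)"
proof -
  let ?f = "\<lambda>k. fps_nth (fps_ln 1) k * x ^ k"
  have "?f \<longlonglongrightarrow> 0"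
    using vabs_fps_ln_power_term[OF assms, of 1] by (intro tendsto_0_vabs_le[OF _ tendsto_ratio_power]) simp
  then have s: "summable ?f" by (rule summable_of_null[OF complete_UNIV])
  then obtain l where l: "?f sums l" by (auto simp: summable_def)
  then have "(\<lambda>n. \<Sum>k<Suc n. ?f k) \<longlonglongrightarrow> l"
    unfolding sums_def by (rule LIMSEQ_Suc)
  moreover have "(\<Sum>k<Suc n. ?f k) = (\<Sum>k<n. (-1) ^ k * (1 + x - 1) ^ Suc k / of_nat (Suc k))" for n
    \<comment> \<open>The constant coefficient of \<open>fps_ln 1\<close> is 0, while the series
      defining \<open>padic_log\<close> begins with the linear term; hence the shift by one.\<close>
    by (subst sum.lessThan_Suc_shift) (simp add: fps_ln_nth)
  ultimately have "(\<lambda>k. (-1) ^ k * (1 + x - 1) ^ Suc k / of_nat (Suc k)) sums l"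
    by (simp only: sums_def)
  then show ?thesis
    using l unfolding padic_log_def by (simp only: sums_unique[symmetric])
qed

lemma padic_log_power_sums:
  assumes "vabs (x::'c) \<le> 1 / real p"
  shows "(\<lambda>k. fps_nth (fps_ln 1 ^ m) k * x ^ k) sums (padic_log (1 + x) ^ m)"
proof (induction m)
  case 0
  have "(\<lambda>k. fps_nth (1 :: 'c fps) k * x ^ k) sums (\<Sum>k\<in>{0}. fps_nth (1 :: 'c fps) k * x ^ k)"
    by (rule sums_finite) auto
  then show ?case by simp
next
  case (Suc m)
  have "fps_nth (fps_ln 1 ^ Suc m) n * x ^ n =
     (\<Sum>i\<le>n. fps_nth (fps_ln 1) i * x ^ i * (fps_nth (fps_ln 1 ^ m) (n - i) * x ^ (n - i)))" for n
    unfolding power_Suc fps_mult_nth sum_distrib_right atLeast0AtMost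
    by (intro sum.cong refl) (simp add: mult_ac flip: power_add)
  then show ?case
    using Cauchy_product_sums_nonarch[OF padic_log_sums[OF assms] Suc.IH] by simp
qed

text \<open>From \<open>\<theta> < p\<close> the \<open>k\<close>-th coefficient is at most
  \<open>p ^ (k - 1)\<close>, which leaves \<open>1 / p\<close> against
  \<open>x ^ k\<close>.\<close>

lemma vabs_padic_log_le:
  assumes "vabs (x::'c) \<le> 1 / real p"
  shows "vabs (padic_log (1 + x)) \<le> 1 / real p"
proof (rule vabs_suminf_le[OF padic_log_sums[OF assms]])
  fix k
  show "vabs (fps_nth (fps_ln 1) k * x ^ k) \<le> 1 / real p"
  proof (cases "k = 0")
    case False
    have "vabs (fps_nth (fps_ln (1::'c)) k) \<le> \<theta> ^ (k - 1)"
      using vabs_fps_ln_power[of 1 k] False by simp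
    also have "\<dots> \<le> real p ^ (k - 1)"
      using theta_less_p theta_ge_1 by (intro power_mono) auto
    finally have "vabs (fps_nth (fps_ln (1::'c)) k) * vabs (x ^ k) \<le> real p ^ (k - 1) * (1 / real p) ^ k"
      using vabs_power_le[OF assms] by (intro mult_mono) (auto simp: vabs_nonneg)
    also have "\<dots> = 1 / real p"
      using False p_ge_3 by (cases k) (auto simp: power_divide)
    finally show ?thesis by (simp add: vabs_mult)
  qed (simp add: fps_ln_nth)
qed

text \<open>The formal counterpart of \<open>padic_exp_log\<close>: exponential minus 1 and
  logarithm are inverse under composition, and the case of \<open>n\<close> follows by taking
  powers.\<close>

lemma fps_exp_compose_ln: "fps_exp (of_nat n) oo fps_ln 1 = ((1 + fps_X) ^ n :: 'c fps)"
proof -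
  let ?L = "fps_ln (1::'c)"
  have L0: "fps_nth ?L 0 = 0" by (simp add: fps_ln_nth)
  have "(fps_exp 1 - 1) oo ?L = fps_X"
    using fps_inv_right[of "fps_exp (1::'c) - 1"] fps_ln_fps_exp_inv[of "1::'c"] by simp
  then have "fps_exp 1 oo ?L = 1 + fps_X"
    by (simp add: fps_compose_sub_distrib algebra_simps)
  moreover have "fps_exp (of_nat n) = fps_exp (1::'c) ^ n"
    by (simp add: fps_exp_power_mult)
  ultimately show ?thesis
    using fps_compose_power[OF L0, of "fps_exp 1" n] by simp
qed

lemma one_plus_power_eq_sums:
  "(\<lambda>k. fps_nth ((1 + fps_X) ^ n) k * x ^ k) sums ((1 + x) ^ n :: 'c)"
proof -
  have c: "fps_nth ((1 + fps_X) ^ n) k = (of_nat (n choose k) :: 'c)" for k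
    by (metis binomial_gbinomial fps_binomial_nth fps_binomial_of_nat)
  have "(\<lambda>k. of_nat (n choose k) * x ^ k) sums (\<Sum>k\<le>n. of_nat (n choose k) * x ^ k)"
    by (rule sums_finite) auto
  also have "(\<Sum>k\<le>n. of_nat (n choose k) * x ^ k) = (1 + x) ^ n"
    using binomial_ring[of x 1 n] by (simp add: add.commute)
  finally show ?thesis by (simp add: c)
qed

text \<open>The formal identity becomes one between values by exchanging the sums of a double
  series. The bounds \<open>\<theta> ^ m\<close> for \<open>1 / fact m\<close> and
  \<open>\<theta> ^ (k - m)\<close> for the powers of the logarithm multiply to
  \<open>\<theta> ^ k\<close>, which \<open>x ^ k\<close> overcomes because
  \<open>\<theta> < p\<close>.\<close>

lemma padic_exp_log:
  assumes x: "vabs (x::'c) \<le> 1 / real p"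
  shows "padic_exp (of_nat n * padic_log (1 + x)) = (1 + x) ^ n"
proof -
  let ?c = "\<lambda>m. of_nat n ^ m / fact m :: 'c"
  \<comment> \<open>\<open>k\<close> is the power of \<open>x\<close> and \<open>m\<close> that of
    the logarithm: summing over \<open>m\<close> first gives the coefficients of the formal
    composition, summing over \<open>k\<close> first the terms of the exponential series.\<close>
  define u where "u k m = ?c m * (fps_nth (fps_ln 1 ^ m) k * x ^ k)" for k m
  have u0: "u k m = 0" if "k < m" for k m
    using vabs_fps_ln_power[of m k] that by (simp add: u_def)
  have "vabs (u k m) \<le> (\<theta> / real p) ^ max k m" for k m
  proof (cases "k < m")
    case True
    then show ?thesis using u0 theta_ge_1 by simp
  next
    case False
    have "vabs (?c m) = vabs (of_nat n :: 'c) ^ m * (1 / vabs (fact m :: 'c))"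
      by (simp add: vabs_divide vabs_power)
    also have "\<dots> \<le> 1 * \<theta> ^ m"
      using vabs_fact_ge'[of m] vabs_of_nat_le_1[of n, where 'c='c]
      by (intro mult_mono power_le_one) (auto simp: vabs_nonneg)
    finally have c: "vabs (?c m) \<le> \<theta> ^ m" by simp
    have "vabs (u k m) = vabs (?c m) * (vabs (fps_nth (fps_ln (1::'c) ^ m) k) * vabs (x ^ k))"
      unfolding u_def vabs_mult ..
    also have "\<dots> \<le> \<theta> ^ m * (\<theta> ^ (k - m) * (1 / real p) ^ k)"
      using c vabs_fps_ln_power[of m k] False vabs_power_le[OF x, of k] theta_ge_1
      by (intro mult_mono) (auto simp: vabs_nonneg)
    also have "\<dots> = (\<theta> / real p) ^ k"
      using False by (simp add: power_divide flip: power_add)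
    finally show ?thesis using False by (simp add: max_def)
  qed
  then have u: "null2 u"
    using theta_ge_1 theta_less_p by (intro null2I_geometric) auto
  have row: "(\<Sum>m. u k m) = fps_nth ((1 + fps_X) ^ n) k * x ^ k" for k
  proof -
    have "(\<Sum>m. u k m) = (\<Sum>m\<le>k. u k m)"
      by (rule suminf_finite) (auto simp: u0)
    also have "\<dots> = fps_nth (fps_exp (of_nat n) oo fps_ln 1) k * x ^ k"
      unfolding fps_compose_nth u_def sum_distrib_right atLeast0AtMost
      by (intro sum.cong refl) simp
    finally show ?thesis by (simp add: fps_exp_compose_ln)
  qed
  have "(\<lambda>m. \<Sum>k. u k m) sums ((1 + x) ^ n)"
    using one_plus_power_eq_sums[of n x] by (intro suminf_swap[OF complete_UNIV u]) (simp add: row)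
  moreover have "(\<Sum>k. u k m) = (of_nat n * padic_log (1 + x)) ^ m / fact m" for m
    using sums_unique[OF sums_cmult[OF padic_log_power_sums[OF x, of m], of "?c m"]]
    by (simp add: u_def power_mult_distrib mult_ac)
  ultimately have "(\<lambda>m. (of_nat n * padic_log (1 + x)) ^ m / fact m) sums ((1 + x) ^ n)"
    by simp
  then show ?thesis
    unfolding padic_exp_def by (rule sums_unique[symmetric])
qed

text \<open>With \<open>vabs L \<le> 1 / p\<close> the \<open>n\<close>-th coefficient in
  \<open>s\<close> is at most \<open>(\<theta> / p) ^ n\<close>, which yields exactly the radius
  \<open>p / \<theta>\<close>.\<close>

lemma analytic_padic_exp:
  assumes "vabs (L::'c) \<le> 1 / real p"
  shows "analytic_on_disc (real p / \<theta>) (\<lambda>s. padic_exp (- s * L))"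
  unfolding analytic_on_disc_def
proof (intro exI allI impI)
  fix s :: 'c assume s: "vabs s < real p / \<theta>"
  let ?f = "\<lambda>n. (- L) ^ n / fact n * s ^ n"
  have r: "0 \<le> vabs s * \<theta> / real p" "vabs s * \<theta> / real p < 1"
    using s theta_ge_1 p_ge_3 vabs_nonneg[of s] by (auto simp: field_simps)
  have "vabs (?f n) \<le> (vabs s * \<theta> / real p) ^ n" for n
  proof -
    have "vabs (?f n) = vabs L ^ n * (1 / vabs (fact n :: 'c)) * vabs s ^ n"
      by (simp add: vabs_mult vabs_divide vabs_power)
    also have "\<dots> \<le> (1 / real p) ^ n * \<theta> ^ n * vabs s ^ n"
      using assms vabs_fact_ge'[of n] theta_ge_1
      by (intro mult_right_mono mult_mono power_mono) (auto simp: vabs_nonneg)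
    finally show ?thesis by (simp add: power_divide power_mult_distrib mult_ac)
  qed
  then have "?f \<longlonglongrightarrow> 0"
    by (rule tendsto_0_vabs_le) (use r in \<open>auto intro!: LIMSEQ_power_zero\<close>)
  then have "?f sums suminf ?f"
    using summable_of_null[OF complete_UNIV] summable_sums by blast
  also have "?f = (\<lambda>n. (- s * L) ^ n / fact n)"
    by (simp add: fun_eq_iff power_mult_distrib[symmetric] mult_ac)
  finally show "?f sums padic_exp (- s * L)"
    by (simp add: padic_exp_def power_mult_distrib[symmetric] mult_ac)
qed

subsection \<open>Teichmueller representatives\<close>

text \<open>If \<open>w\<close> were not 1, its powers up to exponent \<open>p - 2\<close> would sum
  to 0. Each of them is within distance less than 1 of 1, so \<open>p - 1\<close> would have
  absolute value below 1, although \<open>p\<close> does not divide it.\<close>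

lemma root_of_unity_eq_1:
  assumes "(w::'c) ^ (p - 1) = 1" and "vabs (w - 1) < 1"
  shows "w = 1"
proof (rule ccontr)
  assume "w \<noteq> 1"
  have "(w - 1) * (\<Sum>i<p - 1. w ^ i) = 0"
    using assms(1) power_diff_1_eq[of w "p - 1"] by simp
  with \<open>w \<noteq> 1\<close> have 0: "(\<Sum>i<p - 1. w ^ i) = 0" by simp
  have w: "vabs w = 1"
    using vabs_eq_of_diff_less[of w 1] assms(2) by simp
  have "vabs (w ^ i - 1) < 1" for i
  proof -
    have "vabs (\<Sum>j<i. w ^ j) \<le> 1" by (rule vabs_sum_le) (auto simp: vabs_power w)
    then have "vabs (w - 1) * vabs (\<Sum>j<i. w ^ j) \<le> vabs (w - 1)"
      by (simp add: mult_left_le vabs_nonneg)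
    then show ?thesis
      using assms(2) power_diff_1_eq[of w i] by (simp add: vabs_mult)
  qed
  then have "vabs (\<Sum>i<p - 1. w ^ i - 1) < 1" by (intro vabs_sum_less) auto
  then have "vabs (of_nat (p - 1) :: 'c) < 1"
    using 0 by (simp add: sum_subtractf)
  moreover have "\<not> p dvd p - 1"
    using p_ge_3 by (auto dest: dvd_imp_le)
  ultimately show False using vabs_of_nat_unit by fastforce
qed

text \<open>The representative is the limit of \<open>a ^ (p ^ n)\<close>. Euler's theorem modulo
  \<open>p ^ Suc n\<close> shows both that consecutive terms get close and that their powers with
  exponent \<open>p - 1\<close> tend to 1.\<close>

lemma teichmueller_exists:
  assumes "\<not> p dvd a"
  shows "\<exists>w::'c. w ^ (p - 1) = 1 \<and> vabs (w - of_nat a) \<le> 1 / real p"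
proof -
  define X where "X n = (of_nat (a ^ p ^ n) :: 'c)" for n
  have cop: "coprime a (p ^ k)" for k
    using assms prime_p by (metis coprime_commute coprime_power_right_iff prime_imp_coprime)
  have X1: "vabs (X n ^ (p - 1) - 1) \<le> (1 / real p) ^ Suc n" for n
  proof -
    have "[a ^ totient (p ^ Suc n) = 1] (mod p ^ Suc n)"
      by (rule euler_theorem[OF cop])
    then have "[(a ^ p ^ n) ^ (p - 1) = 1] (mod p ^ Suc n)"
      by (simp only: totient_prime_power_Suc[OF prime_p] power_mult)
    from vabs_of_nat_cong[OF this] show ?thesis by (simp add: X_def)
  qed
  have XS: "X (Suc n) - X n = X n * (X n ^ (p - 1) - 1)" for n
  proof -
    have "X (Suc n) = X n ^ p"
      by (simp add: X_def mult.commute flip: power_mult)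
    also have "\<dots> = X n * X n ^ (p - 1)"
      using p_ge_3 by (simp add: power_eq_if)
    finally show ?thesis by (simp add: algebra_simps)
  qed
  have vX: "vabs (X n) \<le> 1" for n
    by (simp add: X_def vabs_of_nat_le_1 del: of_nat_power)
  have d: "vabs (X (Suc n) - X n) \<le> (1 / real p) ^ Suc n" for n
    unfolding XS vabs_mult using mult_mono[OF vX[of n] X1[of n]] by (simp add: vabs_nonneg)
  have z: "(\<lambda>n. (1 / real p) ^ Suc n) \<longlonglongrightarrow> 0"
    using p_ge_3 by (intro LIMSEQ_Suc LIMSEQ_power_zero) auto
  have "summable (\<lambda>n. X (Suc n) - X n)"
    by (rule summable_of_null[OF complete_UNIV tendsto_0_vabs_le[OF d z]])
  then obtain l where l: "(\<lambda>n. X (Suc n) - X n) sums l" by (auto simp: summable_def)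
  define w where "w = l + X 0"
  have "(\<lambda>n. X n - X 0 + X 0) \<longlonglongrightarrow> w"
    using l unfolding sums_def w_def by (intro tendsto_add tendsto_const) (simp add: sum_lessThan_telescope)
  then have w: "X \<longlonglongrightarrow> w" by simp
  have "(\<lambda>n. X n ^ (p - 1) - 1) \<longlonglongrightarrow> w ^ (p - 1) - 1"
    by (intro tendsto_diff tendsto_power_strong tendsto_const w)
  moreover have "(\<lambda>n. X n ^ (p - 1) - 1) \<longlonglongrightarrow> 0"
    by (rule tendsto_0_vabs_le[OF X1 z])
  ultimately have "w ^ (p - 1) - 1 = 0" by (rule LIMSEQ_unique)
  moreover have "vabs (w - of_nat a) \<le> 1 / real p"
  proof -
    have "vabs (X (Suc n) - X n) \<le> 1 / real p" for n
      using d[of n] power_decreasing[of 1 "Suc n" "1 / real p"] p_ge_3 by simp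
    then have "vabs l \<le> 1 / real p" using vabs_suminf_le[OF l] by blast
    then show ?thesis by (simp add: w_def X_def)
  qed
  ultimately show ?thesis by auto
qed

text \<open>The quotient of two candidates is a root of unity close to 1.\<close>

lemma teichmueller_unique:
  assumes "\<not> p dvd a" and "(w::'c) ^ (p - 1) = 1" "vabs (w - of_nat a) < 1"
    and "v ^ (p - 1) = 1" "vabs (v - of_nat a) < 1"
  shows "v = w"
proof -
  have w: "vabs w = 1"
    using vabs_eq_of_diff_less[of w "of_nat a"] assms vabs_of_nat_unit by simp
  then have "w \<noteq> 0" by auto
  have "v - w = (v - of_nat a) - (w - of_nat a)" by simp
  also have "vabs \<dots> < 1" by (rule le_less_trans[OF vabs_diff_le]) (use assms in simp)
  finally have "vabs (v / w - 1) < 1"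
    using w \<open>w \<noteq> 0\<close> vabs_divide[of "v - w" w] by (simp add: diff_divide_distrib)
  moreover have "(v / w) ^ (p - 1) = 1"
    using assms by (simp add: power_divide)
  ultimately have "v / w = 1" by (rule root_of_unity_eq_1[rotated])
  then show ?thesis using \<open>w \<noteq> 0\<close> by simp
qed

lemma teichmueller_eqI:
  assumes "\<not> p dvd a" and "(w::'c) ^ (p - 1) = 1" "vabs (w - of_nat a) < 1"
  shows "teichmueller p a = w"
proof -
  have "(THE w::'c. w ^ (p - 1) = 1 \<and> vabs (w - of_nat a) < 1) = w"
    by (rule the_equality) (use assms teichmueller_unique[OF assms] in blast)+
  then show ?thesis using assms(1) by (simp only: teichmueller_def if_False)
qed

text \<open>The definition asks only for distance below 1. The limit construction gives the sharper
  \<open>1 / p\<close> on which the logarithm estimates rest.\<close>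

lemma teichmueller:
  assumes "\<not> p dvd a"
  shows "teichmueller p a ^ (p - 1) = (1::'c)"
    and "vabs (teichmueller p a - of_nat a :: 'c) \<le> 1 / real p"
proof -
  obtain w :: 'c where w: "w ^ (p - 1) = 1" "vabs (w - of_nat a) \<le> 1 / real p"
    using teichmueller_exists[OF assms] by (elim exE conjE)
  have "teichmueller p a = w"
    by (rule teichmueller_eqI[OF assms w(1) le_less_trans[OF w(2) one_over_p_less_1]])
  with w show "teichmueller p a ^ (p - 1) = (1::'c)"
    and "vabs (teichmueller p a - of_nat a :: 'c) \<le> 1 / real p" by simp_all
qed

lemma vabs_teichmueller: "\<not> p dvd a \<Longrightarrow> vabs (teichmueller p a :: 'c) = 1"
  using vabs_eq_of_diff_less[of "teichmueller p a :: 'c" "of_nat a"]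
    teichmueller(2)[of a] one_over_p_less_1 vabs_of_nat_unit[of a] by simp

lemma teichmueller_eq_0_iff: "teichmueller p a = (0::'c) \<longleftrightarrow> p dvd a"
  using vabs_teichmueller[of a] by (auto simp: teichmueller_def[of p a])

lemma teichmueller_mult: "teichmueller p (a * b) = (teichmueller p a * teichmueller p b :: 'c)"
proof (cases "p dvd a * b")
  case True
  then show ?thesis
    using prime_p by (auto simp: teichmueller_def prime_dvd_mult_iff)
next
  case False
  then have ab: "\<not> p dvd a" "\<not> p dvd b" by auto
  show ?thesis
  proof (rule teichmueller_eqI[OF False])
    show "(teichmueller p a * teichmueller p b) ^ (p - 1) = (1::'c)"
      by (simp only: power_mult_distrib teichmueller(1)[OF ab(1)] teichmueller(1)[OF ab(2)] mult_1)
    let ?u = "teichmueller p a - of_nat a :: 'c" and ?v = "teichmueller p b - of_nat b :: 'c"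
    have eq: "teichmueller p a * teichmueller p b - of_nat (a * b) =
        ?u * teichmueller p b + of_nat a * ?v"
      by (simp add: algebra_simps)
    show "vabs (teichmueller p a * teichmueller p b - of_nat (a * b) :: 'c) < 1"
      unfolding eq
      by (rule le_less_trans[OF vabs_add_le])
        (use teichmueller(2)[OF ab(1)] teichmueller(2)[OF ab(2)] one_over_p_less_1 in
          \<open>simp add: vabs_mult vabs_teichmueller ab vabs_of_nat_unit\<close>)
  qed
qed

lemma teichmueller_cong:
  assumes "[a = b] (mod p)"
  shows "teichmueller p a = (teichmueller p b :: 'c)"
proof (cases "p dvd a")
  case True
  then show ?thesis using assms by (simp add: teichmueller_def cong_dvd_iff)
next
  case False
  then have b: "\<not> p dvd b" using assms cong_dvd_iff by blast
  show ?thesis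
  proof (rule teichmueller_eqI[OF False teichmueller(1)[OF b]])
    have "teichmueller p b - of_nat a = (teichmueller p b - of_nat b) - (of_nat a - of_nat b :: 'c)"
      by simp
    also have "vabs \<dots> < 1"
      by (rule le_less_trans[OF vabs_diff_le])
        (use teichmueller(2)[OF b] vabs_of_nat_cong[of a b 1] assms one_over_p_less_1 in simp)
    finally show "vabs (teichmueller p b - of_nat a :: 'c) < 1" .
  qed
qed

lemma vabs_one_unit_minus_1:
  assumes "\<not> p dvd a"
  shows "vabs (one_unit p a - 1 :: 'c) \<le> 1 / real p"
proof -
  have "teichmueller p a \<noteq> (0::'c)" using assms by (simp add: teichmueller_eq_0_iff)
  then have "one_unit p a - 1 = (of_nat a - teichmueller p a) / (teichmueller p a :: 'c)"
    by (simp add: one_unit_def diff_divide_distrib)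
  then show ?thesis
    using teichmueller(2)[OF assms] vabs_teichmueller[OF assms]
    by (simp add: vabs_divide vabs_diff_commute)
qed

lemma one_unit_pow_of_nat:
  assumes "\<not> p dvd a"
  shows "one_unit_pow p a (of_nat n) = (one_unit p a ^ n :: 'c)"
  using padic_exp_log[OF vabs_one_unit_minus_1[OF assms], of n] by (simp add: one_unit_pow_def)

lemma analytic_one_unit_pow:
  assumes "\<not> p dvd a"
  shows "analytic_on_disc (real p / \<theta>) (\<lambda>s::'c. one_unit_pow p a (- s))"
  using analytic_padic_exp[OF vabs_padic_log_le[OF vabs_one_unit_minus_1[OF assms]]]
  by (simp add: one_unit_pow_def)

subsection \<open>Binomial series\<close>

text \<open>The polynomial is the numerator of the binomial coefficient of \<open>- s\<close>,
  namely the product of the factors \<open>- i - s\<close>. Its coefficients are integers, hence of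
  absolute value at most 1.\<close>

lemma vabs_falling_coeff:
  "vabs (Polynomial.coeff (\<Prod>i<k. [:- of_nat i, - 1:] :: 'c poly) j) \<le> 1"
proof (induction k arbitrary: j)
  case 0
  then show ?case by (simp add: coeff_1)
next
  case (Suc k)
  let ?P = "\<Prod>i<k. [:- of_nat i, - 1:] :: 'c poly"
  have "Polynomial.coeff (\<Prod>i<Suc k. [:- of_nat i, - 1:] :: 'c poly) j =
      - of_nat k * Polynomial.coeff ?P j + (case j of 0 \<Rightarrow> 0 | Suc m \<Rightarrow> - Polynomial.coeff ?P m)"
    by (simp add: mult.commute coeff_pCons split: nat.split)
  also have "vabs \<dots> \<le> max (vabs (of_nat k :: 'c) * vabs (Polynomial.coeff ?P j)) 1"
    by (rule order_trans[OF vabs_add_le])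
      (use Suc in \<open>auto simp: vabs_mult max.coboundedI2 split: nat.split\<close>)
  also have "\<dots> \<le> 1"
    using mult_mono[OF vabs_of_nat_le_1[of k, where 'c='c] Suc[of j]] by (simp add: vabs_nonneg)
  finally show ?case .
qed

text \<open>Each binomial coefficient is expanded in powers of \<open>s\<close> and the double
  series is summed in the other order. Dividing by \<open>fact k\<close> costs
  \<open>\<theta> ^ k\<close>, so the expansion coefficients decay like
  \<open>(\<theta> / p) ^ k\<close>.\<close>

lemma gbinomial_series_analytic:
  fixes b :: "nat \<Rightarrow> 'c"
  assumes b: "\<And>k. vabs (b k) \<le> (1 / real p) ^ k"
  shows "vabs s < real p / \<theta> \<Longrightarrow> summable (\<lambda>k. ((- s) gchoose k) * b k)"
    and "analytic_on_disc (real p / \<theta>) (\<lambda>s. \<Sum>k. ((- s) gchoose k) * b k)"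
proof -
  let ?P = "\<lambda>k. \<Prod>i<k. [:- of_nat i, - 1:] :: 'c poly"
  define C where "C k = b k / fact k" for k
  define u where "u s k j = C k * (Polynomial.coeff (?P k) j * s ^ j)" for s k j
  have deg: "Polynomial.degree (?P k) \<le> k" for k
    using degree_prod_sum_le[of "{..<k}" "\<lambda>i. [:- of_nat i, - 1:] :: 'c poly"] by simp
  have u0: "u s k j = 0" if "k < j" for s k j
    using deg[of k] that by (simp add: u_def coeff_eq_0)
  have row: "(\<Sum>j. u s k j) = ((- s) gchoose k) * b k" for s k
  proof -
    have "(\<Sum>j. u s k j) = (\<Sum>j\<le>k. u s k j)"
      by (rule suminf_finite) (auto simp: u0)
    also have "\<dots> = C k * (\<Sum>j\<le>k. Polynomial.coeff (?P k) j * s ^ j)"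
      by (simp add: u_def sum_distrib_left)
    also have "(\<Sum>j\<le>k. Polynomial.coeff (?P k) j * s ^ j) = poly (?P k) s"
      by (rule poly_as_sum_of_monoms'[OF deg, THEN arg_cong[of _ _ "\<lambda>q. poly q s"],
            unfolded poly_sum poly_monom])
    also have "\<dots> = fact k * ((- s) gchoose k)"
      by (simp add: gbinomial_mult_fact poly_prod atLeast0LessThan minus_diff_commute)
    finally show ?thesis by (simp add: C_def)
  qed
  \<comment> \<open>The maximum with 1 is there because all powers \<open>s ^ j\<close> with
    \<open>j \<le> k\<close> must be dominated by one \<open>k\<close>-th power. For small
    \<open>s\<close> the bound \<open>\<rho> s < 1\<close> then rests on
    \<open>\<theta> < p\<close>.\<close>
  define \<rho> where "\<rho> s = max 1 (vabs s) * \<theta> / real p" for s :: 'c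
  have rho: "0 \<le> \<rho> s" "\<rho> s < 1" if "vabs s < real p / \<theta>" for s
    using that theta_ge_1 theta_less_p p_ge_3 by (auto simp: \<rho>_def field_simps max_def)
  have C: "vabs (C k) \<le> (\<theta> / real p) ^ k" for k
  proof -
    have "vabs (C k) = vabs (b k) * (1 / vabs (fact k :: 'c))"
      by (simp add: C_def vabs_divide)
    also have "\<dots> \<le> (1 / real p) ^ k * \<theta> ^ k"
      using b vabs_fact_ge'[of k] theta_ge_1 by (intro mult_mono) (auto simp: vabs_nonneg)
    finally show ?thesis by (simp add: power_divide)
  qed
  have ub: "vabs (u s k j) \<le> \<rho> s ^ max k j" if s: "vabs s < real p / \<theta>" for s k j
  proof (cases "k < j")
    case True
    then show ?thesis using u0 rho[OF s] by simp
  next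
    case False
    have "vabs s ^ j \<le> max 1 (vabs s) ^ j"
      by (intro power_mono) (auto simp: vabs_nonneg)
    also have "\<dots> \<le> max 1 (vabs s) ^ k"
      using False by (intro power_increasing) auto
    finally have sj: "vabs s ^ j \<le> max 1 (vabs s) ^ k" .
    have "vabs (u s k j) = vabs (C k) * (vabs (Polynomial.coeff (?P k) j) * vabs s ^ j)"
      by (simp add: u_def vabs_mult vabs_power)
    also have "\<dots> \<le> (\<theta> / real p) ^ k * (1 * max 1 (vabs s) ^ k)"
      using C vabs_falling_coeff sj theta_ge_1 by (intro mult_mono) (auto simp: vabs_nonneg)
    also have "\<dots> = \<rho> s ^ k"
      by (simp add: \<rho>_def power_mult_distrib[symmetric] mult_ac)
    finally show ?thesis using False by (simp add: max_def)
  qed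
  have u: "null2 (u s)" if "vabs s < real p / \<theta>" for s
    using null2I_geometric[OF ub[OF that] rho[OF that]] .
  have summ: "summable (\<lambda>k. \<Sum>j. u s k j)" if s: "vabs s < real p / \<theta>" for s
  proof (rule summable_of_null[OF complete_UNIV], rule tendsto_0_vabs_le)
    show "(\<lambda>k. \<rho> s ^ k) \<longlonglongrightarrow> 0"
      using rho[OF s] by (intro LIMSEQ_power_zero) auto
    fix k
    have "vabs (u s k j) \<le> \<rho> s ^ k" for j
    proof -
      have "vabs (u s k j) \<le> \<rho> s ^ max k j" by (rule ub[OF s])
      also have "\<dots> \<le> \<rho> s ^ k" using rho[OF s] by (intro power_decreasing) auto
      finally show ?thesis .
    qed
    then show "vabs (\<Sum>j. u s k j) \<le> \<rho> s ^ k"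
      using vabs_suminf_le[OF summable_sums[OF summable_of_null[OF complete_UNIV null2_tendsto_0[OF u[OF s]]]]]
      by blast
  qed
  then show "vabs s < real p / \<theta> \<Longrightarrow> summable (\<lambda>k. ((- s) gchoose k) * b k)"
    by (simp add: row)
  \<comment> \<open>The coefficient of \<open>s ^ j\<close> collects the contributions of all
    binomial coefficients, so it is itself an infinite series.\<close>
  define c where "c j = (\<Sum>k. C k * Polynomial.coeff (?P k) j)" for j
  have "(\<lambda>j. c j * s ^ j) sums (\<Sum>k. ((- s) gchoose k) * b k)" if s: "vabs s < real p / \<theta>" for s
  proof -
    have "(\<lambda>k. C k * Polynomial.coeff (?P k) j) \<longlonglongrightarrow> 0" for j
    proof (rule tendsto_0_vabs_le[OF _ tendsto_ratio_power])
      show "vabs (C k * Polynomial.coeff (?P k) j) \<le> (\<theta> / real p) ^ k" for k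
        using mult_mono[OF C[of k] vabs_falling_coeff[of k j]] theta_ge_1
        by (simp add: vabs_mult vabs_nonneg)
    qed
    then have cs: "(\<lambda>k. C k * Polynomial.coeff (?P k) j) sums c j" for j
      unfolding c_def by (intro summable_sums summable_of_null[OF complete_UNIV])
    have "(\<Sum>k. u s k j) = c j * s ^ j" for j
      using sums_unique[OF sums_cmult[OF cs[of j], of "s ^ j"]] by (simp add: u_def mult_ac)
    then show ?thesis
      using suminf_swap[OF complete_UNIV u[OF s] summable_sums[OF summ[OF s]]] by (simp add: row)
  qed
  then show "analytic_on_disc (real p / \<theta>) (\<lambda>s. \<Sum>k. ((- s) gchoose k) * b k)"
    unfolding analytic_on_disc_def by blast
qed

end

subsection \<open>Primitive characters\<close>

lemma ex_prime_dvd_of_not_coprime: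
  fixes a b :: nat
  assumes "\<not> coprime a b"
  obtains l where "prime l" "l dvd a" "l dvd b"
proof -
  have "gcd a b \<noteq> 1" using assms unfolding coprime_iff_gcd_eq_1 .
  then obtain l where "prime l" "l dvd gcd a b" using prime_factor_nat by blast
  then show ?thesis using that by simp
qed

text \<open>The multiple of \<open>L\<close> added to \<open>c\<close> is taken with the product
  \<open>k\<close> of those primes of \<open>m\<close> that do not divide \<open>c\<close>. Each
  prime of \<open>m\<close> then divides exactly one of \<open>c\<close> and \<open>k * L\<close>,
  hence not their sum.\<close>

lemma coprime_lift:
  fixes c L m :: nat
  assumes "coprime c L" and "m > 0"
  obtains c' where "[c' = c] (mod L)" "coprime c' m"
proof -
  define k where "k = \<Prod>{l \<in> prime_factors m. \<not> l dvd c}"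
  have "coprime (c + k * L) m"
  proof (rule ccontr)
    assume "\<not> coprime (c + k * L) m"
    then obtain l where l: "prime l" "l dvd c + k * L" "l dvd m"
      by (rule ex_prime_dvd_of_not_coprime)
    have lm: "l \<in> prime_factors m" using l assms(2) by (simp add: in_prime_factors_iff)
    show False
    proof (cases "l dvd c")
      case True
      then have "l dvd k * L" using l(2) dvd_add_right_iff by blast
      moreover have "\<not> l dvd L"
        using assms(1) True l(1) by (meson coprime_common_divisor_nat not_prime_unit coprime_common_divisor)
      ultimately have "l dvd k" using l(1) prime_dvd_mult_iff by blast
      then obtain l' where "l' \<in> prime_factors m" "\<not> l' dvd c" "l dvd l'"
        using l(1) by (auto simp: k_def prime_dvd_prod_iff)
      then show False
        using True l(1) primes_dvd_imp_eq by blast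
    next
      case False
      then have "l dvd k"
        unfolding k_def using lm by (intro dvd_prodI) auto
      then show False using False l(2) dvd_add_left_iff dvd_mult2 by blast
    qed
  qed
  moreover have "[c + k * L = c] (mod L)" by (simp add: cong_def)
  ultimately show ?thesis using that by blast
qed

text \<open>Bezout writes the gcd as \<open>f * x\<close> modulo \<open>g\<close>, and
  \<open>b - a\<close> is \<open>t\<close> times the gcd; so \<open>a + f * x * t\<close> solves
  both congruences.\<close>

lemma chinese_remainder_gcd:
  fixes a b f g :: nat
  assumes "[a = b] (mod gcd f g)" and "f > 0" "g > 0"
  obtains c where "[c = a] (mod f)" "[c = b] (mod g)"
proof -
  obtain x where x: "[int f * x = gcd (int f) (int g)] (mod int g)"
    using cong_solve_int by blast
  have "[int b = int a] (mod int (gcd f g))"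
    using assms(1) by (simp only: cong_int_iff cong_sym)
  then obtain t where "int b - int a = gcd (int f) (int g) * t"
    by (auto simp: cong_iff_dvd_diff)
  then have t: "int b = int a + gcd (int f) (int g) * t" by simp
  define c where "c = int a + int f * x * t"
  have "[c = int a] (mod int f)"
    by (simp add: c_def cong_def mult.assoc)
  moreover have "[c = int b] (mod int g)"
    unfolding t c_def using cong_scalar_right[OF x, of t] by (intro cong_add cong_refl)
  \<comment> \<open>The solution \<open>c\<close> is an integer that may be negative; its residue
    modulo \<open>f * g\<close> is a natural number in the same classes.\<close>
  moreover define c' where "c' = nat (c mod (int f * int g))"
  have "int c' = c mod (int f * int g)" using assms by (simp add: c'_def)
  then have "[int c' = c] (mod int f)" "[int c' = c] (mod int g)"
    by (simp_all add: cong_def mod_mod_cancel)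
  ultimately have "[int c' = int a] (mod int f)" "[int c' = int b] (mod int g)"
    using cong_trans by blast+
  then show ?thesis using that by (simp add: cong_int_iff)
qed

lemma dcharacter_cong:
  assumes "dcharacter m chi" and "[a = b] (mod m)"
  shows "chi a = chi b"
proof -
  have "chi (a + k * m) = chi a" for a k
  proof (induction k)
    case (Suc k)
    have "chi (a + Suc k * m) = chi (a + k * m + m)" by (simp add: algebra_simps)
    with Suc show ?case using assms(1) by (simp add: dcharacter_def)
  qed simp
  then have "chi (a mod m) = chi a" for a
    by (metis mod_div_mult_eq)
  then show ?thesis using assms(2) by (metis cong_def)
qed

lemma coprime_cong_nat:
  fixes a b m :: nat
  assumes "[a = b] (mod m)"
  shows "coprime a m \<longleftrightarrow> coprime b m"
  using assms cong_imp_coprime cong_sym by blast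

text \<open>As \<open>d\<close> is the least modulus of \<open>chi\<close>, it suffices that
  \<open>gcd d g\<close> is one too. If \<open>a\<close> and \<open>b\<close> agree modulo the gcd,
  they are linked by a \<open>c'\<close> congruent to \<open>a\<close> modulo \<open>d\<close> and
  to a lift \<open>b'\<close> of \<open>b\<close> modulo \<open>g\<close>. Both \<open>c'\<close>
  and \<open>b'\<close> are made prime to \<open>m\<close>, because \<open>g\<close> is known to be
  a modulus only there.\<close>

lemma primitive_dvd_modulus:
  assumes chi: "primitive_dcharacter d chi" and m: "m > 0" "d dvd m" "g dvd m"
    and g: "\<And>a b. coprime a m \<Longrightarrow> coprime b m \<Longrightarrow> [a = b] (mod g) \<Longrightarrow> chi a = chi b"
  shows "d dvd g"
proof -
  have dc: "dcharacter d chi" and cd: "conductor d chi = d"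
    using chi by (auto simp: primitive_dcharacter_def)
  have d0: "d > 0" using dc by (simp add: dcharacter_def)
  have g0: "g > 0" using m by (auto intro: Nat.gr0I)
  have "chi a = chi b" if ab: "coprime a d" "coprime b d" "[a = b] (mod gcd d g)" for a b
  proof -
    obtain b' where b': "[b' = b] (mod d)" "coprime b' m"
      using coprime_lift[OF ab(2) m(1)] by blast
    have "[a = b'] (mod gcd d g)"
      using ab(3) cong_dvd_modulus_nat[OF b'(1), of "gcd d g"] cong_sym cong_trans by blast
    then obtain c where c: "[c = a] (mod d)" "[c = b'] (mod g)"
      using chinese_remainder_gcd[OF _ d0 g0] by blast
    have "coprime b' g" using b'(2) m(3) by (meson coprime_divisors dvd_refl)
    then have "coprime c (lcm d g)"
      using c ab(1) coprime_cong_nat[OF c(1)] coprime_cong_nat[OF c(2)]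
      by (meson coprime_divisors coprime_mult_right_iff dvd_refl lcm_least dvd_triv_left dvd_triv_right)
    then obtain c' where c': "[c' = c] (mod lcm d g)" "coprime c' m"
      using coprime_lift[OF _ m(1)] by blast
    have "[c' = a] (mod d)" "[c' = b'] (mod g)"
      using c cong_dvd_modulus_nat[OF c'(1), of d] cong_dvd_modulus_nat[OF c'(1), of g] cong_trans
      by blast+
    then have "chi a = chi c'" "chi c' = chi b'" "chi b' = chi b"
      using dcharacter_cong[OF dc] g c'(2) b' cong_sym by blast+
    then show ?thesis by simp
  qed
  then have "conductor d chi \<le> gcd d g"
    unfolding conductor_def by (intro Least_le) auto
  then have "d \<le> gcd d g" using cd by simp
  then have "d = gcd d g"
    using d0 by (meson dvd_imp_le gcd_dvd1 le_antisym)
  then show ?thesis by (metis gcd_dvd2)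
qed

lemma conductor_dvd:
  assumes "m > 0" and "\<And>a b. coprime a m \<Longrightarrow> coprime b m \<Longrightarrow> [a = b] (mod m) \<Longrightarrow> chi a = chi b"
  shows "conductor m chi dvd m"
    and "coprime a m \<Longrightarrow> coprime b m \<Longrightarrow> [a = b] (mod conductor m chi) \<Longrightarrow> chi a = chi b"
proof -
  let ?P = "\<lambda>f. f dvd m \<and> (\<forall>a b. coprime a m \<and> coprime b m \<and> [a = b] (mod f) \<longrightarrow> chi a = chi b)"
  have "?P m" using assms(2) by simp
  then have "?P (conductor m chi)" unfolding conductor_def by (rule LeastI)
  then show "conductor m chi dvd m"
    and "coprime a m \<Longrightarrow> coprime b m \<Longrightarrow> [a = b] (mod conductor m chi) \<Longrightarrow> chi a = chi b"
    by auto
qed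

text \<open>Resolves the definite description in \<open>prim_char\<close>. Existence and uniqueness
  both come from lifting classes prime to the conductor to integers prime to
  \<open>m\<close>.\<close>

lemma prim_char:
  fixes chi :: "nat \<Rightarrow> 'c::nonarch_field"
  assumes m: "m > 0"
    and per: "\<And>a b. coprime a m \<Longrightarrow> coprime b m \<Longrightarrow> [a = b] (mod m) \<Longrightarrow> chi a = chi b"
    and mult: "\<And>a b. coprime a m \<Longrightarrow> coprime b m \<Longrightarrow> chi (a * b) = chi a * chi b"
    and nz: "\<And>a. coprime a m \<Longrightarrow> chi a \<noteq> 0"
  shows "primitive_dcharacter (conductor m chi) (prim_char m chi)"
    and "coprime a m \<Longrightarrow> prim_char m chi a = chi a"
proof -
  define f where "f = conductor m chi"
  have fm: "f dvd m" and
    fper: "\<And>a b. coprime a m \<Longrightarrow> coprime b m \<Longrightarrow> [a = b] (mod f) \<Longrightarrow> chi a = chi b"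
    unfolding f_def using conductor_dvd[of m chi, OF m per] by blast+
  have f0: "f > 0" using fm m by (auto intro: Nat.gr0I)
  \<comment> \<open>The choice of the lift does not matter: at integers prime to \<open>m\<close>,
    \<open>chi\<close> depends only on the class modulo \<open>f\<close>.\<close>
  define \<psi> where
    "\<psi> a = (if coprime a f then chi (SOME c. [c = a] (mod f) \<and> coprime c m) else 0)" for a
  have lift: "\<exists>c. [c = a] (mod f) \<and> coprime c m" if "coprime a f" for a
    using coprime_lift[OF that m] by blast
  have copf: "coprime a f" if "coprime a m" for a
    using that fm by (meson coprime_divisors dvd_refl)
  have psi: "\<psi> a = chi c" if "[c = a] (mod f)" "coprime c m" for a c
  proof -
    have "coprime a f" using coprime_cong_nat[OF that(1)] copf[OF that(2)] by simp
    then obtain c' where c': "[c' = a] (mod f)" "coprime c' m" "\<psi> a = chi c'"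
      using someI_ex[OF lift[OF \<open>coprime a f\<close>]] unfolding \<psi>_def by auto
    have "[c' = c] (mod f)"
      by (rule cong_trans[OF c'(1) cong_sym[OF that(1)]])
    then show ?thesis using fper[OF c'(2) that(2)] c'(3) by simp
  qed
  have psi0: "\<psi> a = 0" if "\<not> coprime a f" for a
    using that by (simp add: \<psi>_def)
  have dc: "dcharacter f \<psi>"
    unfolding dcharacter_def
  proof (intro conjI allI)
    fix a b
    show "\<psi> (a + f) = \<psi> a"
    proof (cases "coprime a f")
      case True
      then obtain c where c: "[c = a] (mod f)" "coprime c m" using lift by blast
      then have "[c = a + f] (mod f)" by (simp add: cong_def)
      then show ?thesis using psi c by metis
    next
      case False
      then show ?thesis
        using psi0 coprime_cong_nat[of "a + f" a f] by (simp add: cong_def)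
    qed
    show "\<psi> (a * b) = \<psi> a * \<psi> b"
    proof (cases "coprime a f \<and> coprime b f")
      case True
      then obtain c e where c: "[c = a] (mod f)" "coprime c m" and e: "[e = b] (mod f)" "coprime e m"
        using lift by meson
      have "[c * e = a * b] (mod f)" using c e cong_mult by blast
      moreover have "coprime (c * e) m" using c e by simp
      ultimately show ?thesis using psi c e mult by metis
    next
      case False
      then show ?thesis using psi0 by auto
    qed
    show "(\<psi> a = 0) = (\<not> coprime a f)"
      using psi0 psi lift nz by metis
  qed (use f0 in auto)
  have agree: "\<psi> a = chi a" if "coprime a m" for a
    using psi that by simp
  have "conductor f \<psi> = f"
    unfolding conductor_def
  proof (rule Least_equality)
    show "f dvd f \<and> (\<forall>a b. coprime a f \<and> coprime b f \<and> [a = b] (mod f) \<longrightarrow> \<psi> a = \<psi> b)"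
      using dcharacter_cong[OF dc] by auto
    fix g
    assume g: "g dvd f \<and> (\<forall>a b. coprime a f \<and> coprime b f \<and> [a = b] (mod g) \<longrightarrow> \<psi> a = \<psi> b)"
    \<comment> \<open>A modulus \<open>g\<close> of \<open>\<psi>\<close> is also one of
      \<open>chi\<close>, so minimality of \<open>f\<close> passes on.\<close>
    then have "g dvd m \<and> (\<forall>a b. coprime a m \<and> coprime b m \<and> [a = b] (mod g) \<longrightarrow> chi a = chi b)"
      using fm copf agree by (metis dvd_trans)
    then show "f \<le> g"
      unfolding f_def conductor_def by (rule Least_le)
  qed
  with dc have prim: "primitive_dcharacter f \<psi>" by (simp add: primitive_dcharacter_def)
  have uniq: "\<psi>' = \<psi>" if "primitive_dcharacter f \<psi>'" "\<forall>a. coprime a m \<longrightarrow> \<psi>' a = chi a" for \<psi>'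
  proof
    fix a
    have dc': "dcharacter f \<psi>'" using that(1) by (simp add: primitive_dcharacter_def)
    show "\<psi>' a = \<psi> a"
    proof (cases "coprime a f")
      case True
      then obtain c where c: "[c = a] (mod f)" "coprime c m" using lift by blast
      then show ?thesis using dcharacter_cong[OF dc' c(1)] that(2) psi by auto
    next
      case False
      then show ?thesis using dc' psi0 by (simp add: dcharacter_def)
    qed
  qed
  have "prim_char m chi = \<psi>"
    unfolding prim_char_def f_def[symmetric]
    by (rule the_equality) (use prim agree uniq in blast)+
  then show "primitive_dcharacter (conductor m chi) (prim_char m chi)"
    and "coprime a m \<Longrightarrow> prim_char m chi a = chi a"
    using prim agree by (simp_all only: f_def)
qed

context padic_field begin

text \<open>The last claim includes integers \<open>a\<close> prime to \<open>p\<close> but not to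
  \<open>d\<close>, where primitivity of \<open>chi\<close> enters. A prime \<open>l\<close>
  dividing both \<open>a\<close> and \<open>d\<close> differs from \<open>p\<close> and divides the
  conductor of the twist, so both sides vanish.\<close>

lemma twist_char:
  fixes chi :: "nat \<Rightarrow> 'c"
  assumes chi: "primitive_dcharacter d chi"
  shows "primitive_dcharacter (twist_conductor p d chi n) (twist_char p d chi n)"
    and "twist_conductor p d chi n dvd lcm d p"
    and "\<not> p dvd a \<Longrightarrow> twist_char p d chi n a = twist p chi n a"
proof -
  have dc: "dcharacter d chi" using chi by (simp add: primitive_dcharacter_def)
  define m where "m = lcm d p"
  have m: "m > 0" "d dvd m" "p dvd m"
    using dc p_ge_3 by (auto simp: m_def dcharacter_def lcm_pos_nat)
  define f where "f = twist_conductor p d chi n"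
  define \<psi> where "\<psi> = twist_char p d chi n"
  have cop: "coprime a d \<and> \<not> p dvd a" if "coprime a m" for a
  proof
    show "coprime a d" using that m(2) by (meson coprime_divisors dvd_refl)
    have "coprime a p" using that m(3) by (meson coprime_divisors dvd_refl)
    then show "\<not> p dvd a" using prime_p by (metis coprime_absorb_right not_prime_unit)
  qed
  have per: "twist p chi n a = twist p chi n b" if "[a = b] (mod m)" for a b
    using dcharacter_cong[OF dc cong_dvd_modulus_nat[OF that m(2)]]
      teichmueller_cong[OF cong_dvd_modulus_nat[OF that m(3)]] by (simp add: twist_def)
  have mult: "twist p chi n (a * b) = twist p chi n a * twist p chi n b" for a b
    using dc by (simp add: twist_def dcharacter_def teichmueller_mult power_mult_distrib)
  have nz: "twist p chi n a \<noteq> 0" if "coprime a m" for a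
    using dc cop[OF that] by (simp add: twist_def dcharacter_def teichmueller_eq_0_iff)
  note P = prim_char[of m "twist p chi n", OF m(1) per mult nz]
  have prim: "primitive_dcharacter f \<psi>"
    using P(1) by (simp add: f_def \<psi>_def twist_conductor_def twist_char_def m_def)
  have agree: "\<psi> a = twist p chi n a" if "coprime a m" for a
    using P(2) that by (simp add: \<psi>_def twist_char_def m_def)
  have fm: "f dvd m"
    using conductor_dvd(1)[of m "twist p chi n", OF m(1) per] by (simp add: f_def twist_conductor_def m_def)
  have dcf: "dcharacter f \<psi>" using prim by (simp add: primitive_dcharacter_def)
  \<comment> \<open>At integers prime to \<open>m\<close>, \<open>chi\<close> is
    \<open>\<psi>\<close> times a power of the Teichmueller character, so \<open>lcm f p\<close> is
    a modulus for it.\<close>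
  have "d dvd lcm f p"
  proof (rule primitive_dvd_modulus[OF chi m(1,2)])
    show "lcm f p dvd m" using fm m by simp
    fix a b assume ab: "coprime a m" "coprime b m" "[a = b] (mod lcm f p)"
    have "\<psi> a = \<psi> b"
      using dcharacter_cong[OF dcf] cong_dvd_modulus_nat[OF ab(3), of f] by simp
    moreover have "teichmueller p a = (teichmueller p b :: 'c)"
      using teichmueller_cong cong_dvd_modulus_nat[OF ab(3), of p] by simp
    ultimately show "chi a = chi b"
      using agree ab cop by (auto simp: twist_def teichmueller_eq_0_iff)
  qed
  have "\<psi> a = twist p chi n a" if a: "\<not> p dvd a"
  proof (cases "coprime a d")
    case True
    have "coprime a p" using a prime_p by (metis coprime_commute prime_imp_coprime)
    with True have "coprime a (d * p)" by simp
    then have "coprime a m" unfolding m_def by (meson coprime_divisors dvd_refl lcm_least dvd_triv_left dvd_triv_right)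
    then show ?thesis by (rule agree)
  next
    case False
    then obtain l where l: "prime l" "l dvd a" "l dvd d" by (rule ex_prime_dvd_of_not_coprime)
    have "lcm f p dvd f * p" by simp
    then have "l dvd f * p" using l(3) \<open>d dvd lcm f p\<close> by (meson dvd_trans)
    moreover have "\<not> l dvd p" using l a prime_p primes_dvd_imp_eq by blast
    ultimately have "l dvd f" using l(1) prime_dvd_mult_iff by blast
    then have "\<not> coprime a f" using l by (meson coprime_common_divisor not_prime_unit)
    then have "\<psi> a = 0" using dcf by (simp add: dcharacter_def)
    moreover have "chi a = 0" using dc False by (simp add: dcharacter_def)
    ultimately show ?thesis by (simp add: twist_def)
  qed
  then show "primitive_dcharacter (twist_conductor p d chi n) (twist_char p d chi n)"
    and "twist_conductor p d chi n dvd lcm d p"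
    and "\<not> p dvd a \<Longrightarrow> twist_char p d chi n a = twist p chi n a"
    using prim fm by (auto simp: f_def \<psi>_def m_def)
qed

end

subsection \<open>Generating functions of Euler numbers\<close>

text \<open>With the sign kept in the variable, \<open>(-1) ^ a * q ^ a * e ^ (a t)\<close> is a
  pure power, and for odd \<open>M\<close> the denominator \<open>q ^ M * e ^ (M t) + 1\<close>
  takes the form to which geometric sums apply.\<close>

definition euler_var :: "'c::nonarch_field \<Rightarrow> 'c fps" where
  "euler_var q = fps_const (- q) * fps_exp 1"

text \<open>For a character \<open>g\<close> of odd conductor \<open>M > 1\<close>,
  \<open>1 + q\<close> times this is the generating function of its Euler numbers.\<close>

definition euler_gen :: "(nat \<Rightarrow> 'c::nonarch_field) \<Rightarrow> 'c \<Rightarrow> nat \<Rightarrow> 'c fps" where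
  "euler_gen g q M = (\<Sum>a=1..M. fps_const (g a) * euler_var q ^ a) / (1 - euler_var q ^ M)"

lemma euler_var_power: "euler_var q ^ a = fps_const ((- q) ^ a) * fps_exp (of_nat a)"
  by (simp add: euler_var_def power_mult_distrib fps_exp_power_mult)

lemma euler_denominator:
  "odd M \<Longrightarrow> 1 - euler_var q ^ M = fps_const (q ^ M) * fps_exp (of_nat M) + 1"
  by (simp add: euler_var_power fps_const_neg[symmetric] del: fps_const_neg)

lemma euler_denominator_nz: "odd M \<Longrightarrow> 1 + q ^ M \<noteq> 0 \<Longrightarrow> fps_nth (1 - euler_var q ^ M) 0 \<noteq> 0"
  by (simp add: euler_denominator add.commute)

lemma fps_divide_mult_cancel:
  fixes f g :: "'a::field fps"
  assumes "fps_nth g 0 \<noteq> 0"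
  shows "f / g * g = f"
  using assms by (simp add: fps_divide_unit mult.assoc inverse_mult_eq_1)

lemma fps_divide_eqI:
  fixes f g h :: "'a::field fps"
  assumes "fps_nth g 0 \<noteq> 0" and "h * g = f"
  shows "f / g = h"
proof -
  have "g \<noteq> 0" using assms(1) by auto
  moreover have "f / g * g = h * g" using fps_divide_mult_cancel[OF assms(1)] assms(2) by simp
  ultimately show ?thesis by simp
qed

lemma periodic_sum_power:
  fixes Y :: "'a::comm_semiring_1"
  assumes "\<And>a. g (a + P) = g a"
  shows "(\<Sum>a=1..P * r. g a * Y ^ a) = (\<Sum>a=1..P. g a * Y ^ a) * (\<Sum>j<r. (Y ^ P) ^ j)"
proof (induction r)
  case (Suc r)
  have per: "g (a + P * r) = g a" for a
  proof (induction r)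
    case (Suc r)
    then show ?case using assms[of "a + P * r"] by (simp add: algebra_simps)
  qed simp
  have "(\<Sum>a=1..P * Suc r. g a * Y ^ a) =
      (\<Sum>a=1..P * r. g a * Y ^ a) + (\<Sum>a=P * r + 1..P * r + P. g a * Y ^ a)"
    using sum.ub_add_nat[of 1 "P * r" "\<lambda>a. g a * Y ^ a" P] by (simp add: add.commute)
  also have "(\<Sum>a=P * r + 1..P * r + P. g a * Y ^ a) = (\<Sum>a=1..P. g (a + P * r) * Y ^ (a + P * r))"
    using sum.shift_bounds_cl_nat_ivl[of "\<lambda>a. g a * Y ^ a" 1 "P * r" P] by (simp add: add.commute)
  also have "\<dots> = (\<Sum>a=1..P. g a * Y ^ a) * (Y ^ P) ^ r"
    unfolding per sum_distrib_right by (simp add: power_add power_mult mult_ac)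
  finally show ?case using Suc.IH by (simp add: distrib_left)
qed simp

text \<open>Passing from \<open>P\<close> to \<open>P * r\<close> multiplies numerator and
  denominator by the same geometric sum.\<close>

lemma euler_gen_period:
  assumes "\<And>a. g (a + P) = g a" and "odd (P * r)" and "1 + q ^ (P * r) \<noteq> 0" "1 + q ^ P \<noteq> 0"
  shows "euler_gen g q (P * r) = euler_gen g q P"
proof -
  let ?Y = "euler_var q"
  let ?S = "\<Sum>j<r. (?Y ^ P) ^ j"
  have P: "odd P" using assms(2) by simp
  have den: "1 - ?Y ^ (P * r) = (1 - ?Y ^ P) * ?S"
    unfolding power_mult by (rule one_diff_power_eq)
  have num: "(\<Sum>a=1..P * r. fps_const (g a) * ?Y ^ a) = (\<Sum>a=1..P. fps_const (g a) * ?Y ^ a) * ?S"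
    by (rule periodic_sum_power) (simp add: assms(1))
  show ?thesis
    unfolding euler_gen_def
  proof (rule fps_divide_eqI)
    show "fps_nth (1 - ?Y ^ (P * r)) 0 \<noteq> 0" by (rule euler_denominator_nz) fact+
    have "(\<Sum>a=1..P. fps_const (g a) * ?Y ^ a) / (1 - ?Y ^ P) * (1 - ?Y ^ P)
        = (\<Sum>a=1..P. fps_const (g a) * ?Y ^ a)"
      by (rule fps_divide_mult_cancel[OF euler_denominator_nz[OF P assms(4)]])
    then show "(\<Sum>a=1..P. fps_const (g a) * ?Y ^ a) / (1 - ?Y ^ P) * (1 - ?Y ^ (P * r)) =
        (\<Sum>a=1..P * r. fps_const (g a) * ?Y ^ a)"
      unfolding den num by (simp flip: mult.assoc)
  qed
qed

section \<open>Recurrence, integrality and coefficient formulas\<close>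

definition euler_fps :: "'c::nonarch_field \<Rightarrow> 'c fps" where
  "euler_fps Q = fps_const (1 + Q) / (fps_const Q * fps_exp 1 + 1)"

lemma euler_q_fps: "euler_q k Q = fact k * fps_nth (euler_fps Q) k"
  by (simp add: euler_q_def euler_fps_def q_number_2)

lemma euler_fps_mult:
  assumes "1 + Q \<noteq> 0"
  shows "euler_fps Q * (fps_const Q * fps_exp 1 + 1) = fps_const (1 + Q)"
  unfolding euler_fps_def using assms by (intro fps_divide_mult_cancel) (simp add: add.commute)

lemma euler_fps_scale_mult:
  assumes "1 + Q \<noteq> 0"
  shows "(euler_fps Q oo (fps_const c * fps_X)) * (fps_const Q * fps_exp c + 1) = fps_const (1 + Q)"
proof -
  let ?X = "fps_const c * fps_X"
  have X0: "fps_nth ?X 0 = 0" by simp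
  have "fps_const (1 + Q) = (euler_fps Q * (fps_const Q * fps_exp 1 + 1)) oo ?X"
    by (simp only: euler_fps_mult[OF assms] fps_const_compose)
  also have "\<dots> = (euler_fps Q oo ?X) * ((fps_const Q oo ?X) * (fps_exp 1 oo ?X) + (1 oo ?X))"
    by (simp only: fps_compose_mult_distrib[OF X0] fps_compose_add_distrib)
  finally show ?thesis by (simp del: fps_const_add)
qed

text \<open>Compares coefficients after clearing the denominator of the generating series. The term
  \<open>i = k\<close> is moved to the left, where it produces the factor
  \<open>1 + Q\<close>.\<close>

lemma euler_q_recurrence:
  assumes "1 + Q \<noteq> 0"
  shows "(1 + Q) * euler_q k Q = (if k = 0 then 1 + Q else 0) - Q * (\<Sum>i<k. of_nat (k choose i) * euler_q i Q)"
proof -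
  let ?V = "euler_fps Q"
  have "fps_nth (?V * (fps_const Q * fps_exp 1 + 1)) k = (if k = 0 then 1 + Q else 0)"
    unfolding euler_fps_mult[OF assms] by simp
  also have "?V * (fps_const Q * fps_exp 1 + 1) = fps_const Q * (?V * fps_exp 1) + ?V"
    by (simp add: algebra_simps)
  also have "fps_nth \<dots> k = Q * (\<Sum>i\<le>k. fps_nth ?V i / fact (k - i)) + fps_nth ?V k"
    unfolding fps_add_nth fps_mult_left_const_nth by (simp add: fps_mult_nth atLeast0AtMost)
  finally have "fact k * (Q * (\<Sum>i\<le>k. fps_nth ?V i / fact (k - i)) + fps_nth ?V k) =
      fact k * (if k = 0 then 1 + Q else 0)"
    by simp
  then have *: "Q * (fact k * (\<Sum>i\<le>k. fps_nth ?V i / fact (k - i))) + fact k * fps_nth ?V k =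
      (if k = 0 then 1 + Q else 0)"
    unfolding distrib_left mult.left_commute[of Q] by (auto split: if_splits)
  have "fact k * (\<Sum>i\<le>k. fps_nth ?V i / fact (k - i)) = (\<Sum>i\<le>k. of_nat (k choose i) * euler_q i Q)"
    unfolding sum_distrib_left
    by (intro sum.cong refl) (simp add: binomial_fact euler_q_fps)
  also have "\<dots> = (\<Sum>i<k. of_nat (k choose i) * euler_q i Q) + euler_q k Q"
    by (simp add: lessThan_Suc_atMost[symmetric])
  finally show ?thesis
    using * by (simp add: euler_q_fps algebra_simps split: if_splits)
qed

lemma euler_q_0: "1 + Q \<noteq> 0 \<Longrightarrow> euler_q 0 Q = 1"
  using euler_q_recurrence[of Q 0] by simp

lemma vabs_euler_q_le_1:
  assumes "vabs (1 + Q) = 1" and "vabs Q \<le> 1"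
  shows "vabs (euler_q k Q) \<le> 1"
proof (induction k rule: less_induct)
  case (less k)
  have nz: "1 + Q \<noteq> 0" using assms(1) by auto
  have "vabs (of_nat (k choose i) * euler_q i Q) \<le> 1" if "i < k" for i
    using mult_mono[OF vabs_of_nat_le_1[of "k choose i", where 'c='a] less[OF that]]
    by (simp add: vabs_mult vabs_nonneg)
  then have "vabs (\<Sum>i<k. of_nat (k choose i) * euler_q i Q) \<le> 1" by (intro vabs_sum_le) auto
  from mult_mono[OF assms(2) this]
  have "vabs (Q * (\<Sum>i<k. of_nat (k choose i) * euler_q i Q)) \<le> 1"
    by (simp add: vabs_mult vabs_nonneg)
  moreover have "vabs (if k = 0 then 1 + Q else 0) \<le> 1" using assms by simp
  ultimately have "vabs ((1 + Q) * euler_q k Q) \<le> 1"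
    unfolding euler_q_recurrence[OF nz] by (intro order_trans[OF vabs_diff_le]) simp
  then show ?case using assms(1) by (simp add: vabs_mult)
qed

text \<open>Substituting \<open>M t\<close> in the generating series for \<open>q ^ M\<close> gives
  \<open>(1 + q ^ M) / (1 - Y ^ M)\<close> with \<open>Y = euler_var q\<close>. Multiplying by the
  factor \<open>e ^ (a t)\<close> of \<open>Y ^ a\<close> yields the binomial sum, which for
  \<open>M = F\<close> and \<open>a\<close> prime to \<open>p\<close> is \<open>a ^ n\<close> times
  the inner series of \<open>l_pq\<close> at \<open>- n\<close>.\<close>

lemma euler_gen_coeff:
  assumes M: "odd M" and nz: "1 + q ^ M \<noteq> 0"
  shows "fact n * fps_nth (fps_const (1 + q) * euler_gen g q M) n =
    (1 + q) / (1 + q ^ M) * (\<Sum>a=1..M. g a * (- q) ^ a *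
       (\<Sum>k\<le>n. of_nat (n choose k) * of_nat a ^ (n - k) * of_nat M ^ k * euler_q k (q ^ M)))"
proof -
  let ?V = "euler_fps (q ^ M) oo (fps_const (of_nat M) * fps_X)"
  have V: "fps_nth ?V k = of_nat M ^ k * fps_nth (euler_fps (q ^ M)) k" for k
    by (simp add: fps_compose_linear)
  have gen: "euler_gen g q M =
      fps_const (1 / (1 + q ^ M)) * (\<Sum>a=1..M. fps_const (g a * (- q) ^ a) * (fps_exp (of_nat a) * ?V))"
    unfolding euler_gen_def
  proof (rule fps_divide_eqI)
    show "fps_nth (1 - euler_var q ^ M) 0 \<noteq> 0" by (rule euler_denominator_nz[OF M nz])
    have "fps_const (1 / (1 + q ^ M)) * (?V * (1 - euler_var q ^ M)) = 1"
      unfolding euler_denominator[OF M] euler_fps_scale_mult[OF nz] fps_const_mult using nz by simp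
    then have "fps_const (g a * (- q) ^ a) * fps_exp (of_nat a) *
          (fps_const (1 / (1 + q ^ M)) * (?V * (1 - euler_var q ^ M)))
        = fps_const (g a) * euler_var q ^ a" for a
      by (simp only: mult_1_right euler_var_power fps_const_mult[symmetric] mult.assoc)
    then show "fps_const (1 / (1 + q ^ M)) *
        (\<Sum>a=1..M. fps_const (g a * (- q) ^ a) * (fps_exp (of_nat a) * ?V)) * (1 - euler_var q ^ M) =
        (\<Sum>a=1..M. fps_const (g a) * euler_var q ^ a)"
      unfolding sum_distrib_left sum_distrib_right
      by (intro sum.cong refl) (simp only: mult_ac)
  qed
  have co: "fact n * fps_nth (fps_exp (of_nat a) * ?V) n =
      (\<Sum>k\<le>n. of_nat (n choose k) * of_nat a ^ (n - k) * of_nat M ^ k * euler_q k (q ^ M))" for a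
  proof -
    have "fact n * fps_nth (fps_exp (of_nat a) * ?V) n =
        (\<Sum>k\<le>n. fact n * (fps_nth ?V k * (of_nat a ^ (n - k) / fact (n - k))))"
      by (simp add: mult.commute[of "fps_exp (of_nat a)"] fps_mult_nth sum_distrib_left atLeast0AtMost)
    also have "\<dots> = (\<Sum>k\<le>n. of_nat (n choose k) * of_nat a ^ (n - k) * of_nat M ^ k * euler_q k (q ^ M))"
      unfolding V by (intro sum.cong refl) (simp add: binomial_fact euler_q_fps)
    finally show ?thesis .
  qed
  have "fact n * fps_nth (fps_const (1 + q) * euler_gen g q M) n =
      (1 + q) / (1 + q ^ M) * (\<Sum>a=1..M. g a * (- q) ^ a * (fact n * fps_nth (fps_exp (of_nat a) * ?V) n))"
    unfolding gen fps_mult_left_const_nth fps_sum_nth sum_distrib_left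
    by (intro sum.cong refl) simp
  then show ?thesis by (simp only: co)
qed

text \<open>In the case \<open>f = 1\<close> the numerator is \<open>1 + Q\<close> on one side and
  \<open>(1 + Q) * Y\<close> on the other. As \<open>Y / (1 - Y) = 1 / (1 - Y) - 1\<close>, the
  series differ only in the constant term, which \<open>n > 0\<close> avoids.\<close>

lemma euler_char_q_gen:
  assumes psi: "dcharacter f \<psi>" and f: "odd f" and nz: "1 + Q \<noteq> 0" "1 + Q ^ f \<noteq> 0" and n: "n > 0"
  shows "euler_char_q n f \<psi> Q = fact n * fps_nth (fps_const (1 + Q) * euler_gen \<psi> Q f) n"
proof (cases "f = 1")
  case True
  have "\<psi> 1 = \<psi> 1 * \<psi> 1" "\<psi> 1 \<noteq> 0"
    using psi True unfolding dcharacter_def by (metis mult_1, simp)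
  then have psi1: "\<psi> 1 = 1" by simp
  let ?Y = "euler_var Q"
  have den: "1 - ?Y = fps_const Q * fps_exp 1 + 1"
    using euler_denominator[of 1 Q] by simp
  have Y0: "fps_nth (1 - ?Y) 0 \<noteq> 0"
    using euler_denominator_nz[of 1 Q] nz by simp
  have "euler_gen \<psi> Q f = ?Y / (1 - ?Y)"
    using True psi1 by (simp add: euler_gen_def)
  then have "fps_const (1 + Q) * euler_gen \<psi> Q f * (1 - ?Y) = fps_const (1 + Q) * ?Y"
    using fps_divide_mult_cancel[OF Y0, of ?Y] by (simp only: mult.assoc)
  moreover have "(euler_fps Q - fps_const (1 + Q)) * (1 - ?Y) = fps_const (1 + Q) * ?Y"
    using euler_fps_mult[OF nz(1)] unfolding den[symmetric] left_diff_distrib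
    by (simp add: right_diff_distrib del: fps_const_add)
  moreover have "1 - ?Y \<noteq> 0" using Y0 by auto
  ultimately have "fps_const (1 + Q) * euler_gen \<psi> Q f = euler_fps Q - fps_const (1 + Q)"
    by (metis mult_right_cancel)
  then show ?thesis
    using True n by (simp add: euler_char_q_def euler_q_fps del: fps_const_add)
next
  case False
  have sum: "(\<Sum>a=1..f. fps_const ((-1) ^ a * Q ^ a * \<psi> a) * fps_exp (of_nat a)) =
      (\<Sum>a=1..f. fps_const (\<psi> a) * euler_var Q ^ a)"
    by (intro sum.cong refl)
      (simp only: euler_var_power power_minus[of Q, symmetric] mult.assoc[symmetric] fps_const_mult
        mult.commute[of "\<psi> _" "(- Q) ^ _"])
  have nz0: "fps_nth (1 - euler_var Q ^ f) 0 \<noteq> 0" by (rule euler_denominator_nz[OF f nz(2)])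
  show ?thesis
    using False unfolding euler_char_q_def euler_gen_def sum euler_denominator[OF f, symmetric] q_number_2
    by (simp only: if_False fps_divide_unit[OF nz0] mult.assoc)
qed

lemma euler_var_power_scale:
  assumes "odd p"
  shows "euler_var (q ^ p) oo (fps_const (of_nat p) * fps_X) = euler_var q ^ p"
proof -
  have "fps_exp 1 oo (fps_const (of_nat p) * fps_X) = fps_exp (of_nat p :: 'a)"
    by (simp add: fps_exp_compose_linear)
  then show ?thesis
    using assms by (simp add: euler_var_power, simp add: euler_var_def fps_compose_mult_distrib del: fps_const_neg)
qed

lemma sum_multiples:
  fixes h :: "nat \<Rightarrow> 'a::comm_monoid_add"
  assumes "p > 0"
  shows "(\<Sum>a\<in>{a\<in>{1..p * M}. p dvd a}. h a) = (\<Sum>b=1..M. h (p * b))"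
proof -
  have "{a\<in>{1..p * M}. p dvd a} = (\<lambda>b. p * b) ` {1..M}"
    using assms by (auto simp: image_iff elim!: dvdE) 
  moreover have "inj_on (\<lambda>b. p * b) {1..M}" using assms by (auto simp: inj_on_def)
  ultimately show ?thesis by (simp add: sum.reindex)
qed

text \<open>The multiples of \<open>p\<close> contribute \<open>\<psi> p\<close> times the sum of
  \<open>\<psi> b * (Y ^ p) ^ b\<close>, and \<open>Y ^ p\<close> is the variable for
  \<open>q ^ p\<close> after replacing \<open>t\<close> by \<open>p t\<close>.\<close>

lemma euler_gen_remove_multiples:
  assumes psi: "dcharacter f \<psi>" and p: "prime p" "odd p" and F: "odd F" "p dvd F" "f dvd F"
    and nz: "\<And>k. 1 + q ^ k \<noteq> 0"
  shows "euler_gen (\<lambda>a. if p dvd a then 0 else \<psi> a) q F =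
    euler_gen \<psi> q f -
      fps_const (\<psi> p) * (euler_gen \<psi> (q ^ p) f oo (fps_const (of_nat p) * fps_X))"
proof -
  let ?Y = "euler_var q" and ?X = "fps_const (of_nat p) * fps_X :: 'a fps"
  obtain M where M: "F = p * M" using F(2) by blast
  have X0: "fps_nth ?X 0 = 0" by simp
  have p0: "p > 0" using p prime_gt_0_nat by blast
  have F0: "fps_nth (1 - ?Y ^ F) 0 \<noteq> 0" by (rule euler_denominator_nz[OF F(1) nz])
  have per: "\<psi> (a + f) = \<psi> a" for a using psi by (simp add: dcharacter_def)
  obtain r where "F = f * r" using F(3) by blast
  then have gf: "euler_gen \<psi> q F = euler_gen \<psi> q f"
    using euler_gen_period[of \<psi> f r q] per F(1) nz by metis
  have gp: "fps_const (\<psi> p) * (euler_gen \<psi> (q ^ p) f oo ?X) * (1 - ?Y ^ F) =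
      (\<Sum>b=1..M. fps_const (\<psi> (p * b)) * ?Y ^ (p * b))"
  \<comment> \<open>If \<open>\<psi> p\<close> is 0, both sides vanish. Otherwise \<open>f\<close>
    is prime to \<open>p\<close>, so it divides \<open>M = F / p\<close>, and the series for
    \<open>q ^ p\<close> may be written with \<open>M\<close>.\<close>
  proof (cases "\<psi> p = 0")
    case True
    then have "\<psi> (p * b) = 0" for b
      using psi unfolding dcharacter_def by (metis mult_zero_left)
    then show ?thesis using True by simp
  next
    case False
    then have "coprime p f" using psi by (simp add: dcharacter_def)
    then have "f dvd M"
      using F(3) M by (simp add: coprime_dvd_mult_right_iff coprime_commute)
    then obtain r where r: "M = f * r" by blast
    have nzp: "1 + (q ^ p) ^ k \<noteq> 0" for k using nz[of "p * k"] by (simp add: power_mult)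
    have oM: "odd M" using F(1) M by simp
    have "euler_gen \<psi> (q ^ p) f = euler_gen \<psi> (q ^ p) M"
      using euler_gen_period[of \<psi> f r "q ^ p"] per oM r nzp by metis
    then have "euler_gen \<psi> (q ^ p) f * (1 - euler_var (q ^ p) ^ M) =
        (\<Sum>b=1..M. fps_const (\<psi> b) * euler_var (q ^ p) ^ b)"
      using fps_divide_mult_cancel[OF euler_denominator_nz[OF oM nzp]] by (simp only: euler_gen_def)
    from arg_cong[OF this, of "\<lambda>h. h oo ?X"]
    have "(euler_gen \<psi> (q ^ p) f oo ?X) * (1 - ?Y ^ F) = (\<Sum>b=1..M. fps_const (\<psi> b) * ?Y ^ (p * b))"
      by (simp only: fps_compose_mult_distrib[OF X0] fps_compose_sub_distrib fps_compose_1
          fps_compose_power[OF X0, symmetric] euler_var_power_scale[OF p(2)] fps_compose_sum_distrib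
          fps_const_compose power_mult[symmetric] M)
    then show ?thesis
      using psi by (simp add: mult.assoc dcharacter_def sum_distrib_left flip: fps_const_mult)
  qed
  have "(\<Sum>a=1..F. fps_const (if p dvd a then 0 else \<psi> a) * ?Y ^ a) +
      (\<Sum>a\<in>{a\<in>{1..F}. p dvd a}. fps_const (\<psi> a) * ?Y ^ a) = (\<Sum>a=1..F. fps_const (\<psi> a) * ?Y ^ a)"
    by (subst sum.inter_filter) (auto simp flip: sum.distrib intro!: sum.cong)
  then have num: "(\<Sum>a=1..F. fps_const (if p dvd a then 0 else \<psi> a) * ?Y ^ a) =
      (\<Sum>a=1..F. fps_const (\<psi> a) * ?Y ^ a) - (\<Sum>b=1..M. fps_const (\<psi> (p * b)) * ?Y ^ (p * b))"
    using sum_multiples[OF p0, of "\<lambda>a. fps_const (\<psi> a) * ?Y ^ a" M] by (simp only: M eq_diff_eq)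
  show ?thesis
    unfolding euler_gen_def[of "\<lambda>a. if p dvd a then 0 else \<psi> a"] num
    by (rule fps_divide_eqI[OF F0])
      (simp only: left_diff_distrib gp gf[symmetric] euler_gen_def[of \<psi> q F] fps_divide_mult_cancel[OF F0])
qed

subsection \<open>The p-adic l-function\<close>

text \<open>Nonzero values are roots of unity by Euler's theorem.\<close>

lemma vabs_dcharacter_le_1:
  fixes \<psi> :: "nat \<Rightarrow> 'c::nonarch_field"
  assumes psi: "dcharacter f \<psi>"
  shows "vabs (\<psi> a) \<le> 1"
proof (cases "coprime a f")
  case True
  have f: "f > 0" and mult: "\<And>a b. \<psi> (a * b) = \<psi> a * \<psi> b" and z: "\<And>a. \<psi> a = 0 \<longleftrightarrow> \<not> coprime a f"
    using psi by (simp_all add: dcharacter_def)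
  have one: "\<psi> 1 = 1" using mult[of 1 1] z[of 1] by simp
  have pow: "\<psi> (a ^ k) = \<psi> a ^ k" for k
  proof (induction k)
    case 0
    then show ?case using one by simp
  next
    case (Suc k)
    then show ?case by (simp add: mult)
  qed
  have "\<psi> a ^ totient f = 1"
    using dcharacter_cong[OF psi euler_theorem[OF True]] one pow by simp
  then have "vabs (\<psi> a) ^ totient f = 1"
    by (metis vabs_1 vabs_power)
  moreover have "totient f > 0" using f by simp
  ultimately show ?thesis
    using power_eq_imp_eq_base[of "vabs (\<psi> a)" "totient f" 1] vabs_nonneg[of "\<psi> a"] by simp
next
  case False
  then have "\<psi> a = 0" using psi by (simp add: dcharacter_def)
  then show ?thesis by simp
qed

context padic_field begin

lemma vabs_one_minus_power:
  assumes "vabs (1 - q :: 'c) < 1"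
  shows "vabs q = 1" and "vabs (1 - q ^ k) < 1"
proof -
  show q: "vabs q = 1"
    using vabs_eq_of_diff_less[of q 1] assms by (simp add: vabs_diff_commute)
  have "vabs (\<Sum>i<k. q ^ i) \<le> 1" by (rule vabs_sum_le) (auto simp: vabs_power q)
  then have "vabs (1 - q) * vabs (\<Sum>i<k. q ^ i) \<le> vabs (1 - q)"
    by (simp add: mult_left_le vabs_nonneg)
  then show "vabs (1 - q ^ k) < 1"
    using assms by (simp add: one_diff_power_eq vabs_mult)
qed

text \<open>\<open>1 + q ^ k\<close> is within distance less than 1 of 2, which is a unit because
  \<open>p\<close> is odd.\<close>

lemma vabs_one_plus_power:
  assumes "vabs (1 - q :: 'c) < 1"
  shows "vabs (1 + q ^ k) = 1"
proof -
  have "\<not> p dvd 2" using p_ge_3 by (auto dest: dvd_imp_le)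
  then have 2: "vabs (2 :: 'c) = 1" using vabs_of_nat_unit[of 2] by simp
  have "vabs (1 + q ^ k - 2) < vabs (2 :: 'c)"
    using vabs_one_minus_power(2)[OF assms, of k] 2 vabs_diff_commute[of 1 "q ^ k"] by (simp add: algebra_simps)
  then show ?thesis using vabs_eq_of_diff_less 2 by metis
qed

section \<open>Values at the negative integers\<close>

context
  fixes q :: 'c and chi :: "nat \<Rightarrow> 'c" and d F n :: nat
  assumes q: "vabs (1 - q) < 1" and chi: "primitive_dcharacter d chi" and odd_d: "odd d"
    and F: "odd F" "p dvd F" "d dvd F" and n: "n > 0"
begin

abbreviation (input) "\<chi>\<^sub>n \<equiv> twist_char p d chi n"
abbreviation (input) "f\<^sub>n \<equiv> twist_conductor p d chi n"
abbreviation (input) "\<chi>\<^sub>n\<^sub>p \<equiv> (\<lambda>a. if p dvd a then 0 else \<chi>\<^sub>n a)"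

lemma one_plus_power_nz: "1 + q ^ k \<noteq> 0"
  using vabs_one_plus_power[OF q, of k] by auto

lemma dcharacter_psi: "dcharacter f\<^sub>n \<chi>\<^sub>n"
  using twist_char(1)[OF chi, of n] by (simp add: primitive_dcharacter_def)

lemma twist_conductor_dvd_lcm: "f\<^sub>n dvd lcm d p"
  by (rule twist_char(2)[OF chi])

text \<open>At \<open>- n\<close> the binomial series stops at \<open>k = n\<close>, and
  \<open>chi a\<close> times the \<open>n\<close>-th power of \<open>one_unit p a\<close> is the
  twisted character times \<open>a ^ n\<close>. The sum is then the one computed by
  \<open>euler_gen_coeff\<close>.\<close>

lemma l_pq_neg_nat:
  "l_pq p q F (- of_nat n) chi = fact n * fps_nth (fps_const (1 + q) * euler_gen \<chi>\<^sub>n\<^sub>p q F) n"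
proof -
  let ?T = "\<lambda>a. \<Sum>k\<le>n. of_nat (n choose k) * of_nat a ^ (n - k) * of_nat F ^ k * euler_q k (q ^ F)"
  have tm: "(-1) ^ a * chi a * q ^ a * one_unit_pow p a (- (- of_nat n)) * (\<Sum>k. l_term q F a (- of_nat n) k)
      = \<chi>\<^sub>n a * (- q) ^ a * ?T a" if a: "\<not> p dvd a" for a
  proof -
    have a0: "of_nat a \<noteq> (0::'c)" using vabs_of_nat_unit[OF a] by (metis vabs_0 zero_neq_one)
    have "(\<Sum>k. l_term q F a (- of_nat n) k) =
        (\<Sum>k\<le>n. of_nat (n choose k) * (of_nat F / of_nat a) ^ k * euler_q k (q ^ F))"
      unfolding l_term_def minus_minus binomial_gbinomial[symmetric]
      by (rule suminf_finite) auto
    then have "of_nat a ^ n * (\<Sum>k. l_term q F a (- of_nat n) k) =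
        (\<Sum>k\<le>n. of_nat a ^ n * (of_nat (n choose k) * (of_nat F / of_nat a) ^ k * euler_q k (q ^ F)))"
      by (simp only: sum_distrib_left)
    also have "\<dots> = ?T a"
    proof (rule sum.cong[OF refl])
      fix k assume "k \<in> {..n}"
      then have "of_nat a ^ n = (of_nat a ^ (n - k) * of_nat a ^ k :: 'c)"
        by (simp flip: power_add)
      then show "of_nat a ^ n * (of_nat (n choose k) * (of_nat F / of_nat a) ^ k * euler_q k (q ^ F)) =
          of_nat (n choose k) * of_nat a ^ (n - k) * of_nat F ^ k * euler_q k (q ^ F)"
        using a0 by (simp add: power_divide)
    qed
    finally have T: "of_nat a ^ n * (\<Sum>k. l_term q F a (- of_nat n) k) = ?T a" .
    have "chi a * one_unit_pow p a (- (- of_nat n)) = \<chi>\<^sub>n a * of_nat a ^ n"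
      unfolding minus_minus one_unit_pow_of_nat[OF a] twist_char(3)[OF chi a] twist_def one_unit_def
      by (simp only: divide_inverse power_mult_distrib mult_ac)
    then have U: "\<chi>\<^sub>n a * of_nat a ^ n = chi a * one_unit_pow p a (- (- of_nat n))" ..
    have "(-1) ^ a * chi a * q ^ a * one_unit_pow p a (- (- of_nat n)) * (\<Sum>k. l_term q F a (- of_nat n) k)
        = (-1) ^ a * q ^ a * (\<chi>\<^sub>n a * of_nat a ^ n) * (\<Sum>k. l_term q F a (- of_nat n) k)"
      unfolding U by (simp only: mult_ac)
    also have "\<dots> = (-1) ^ a * q ^ a * \<chi>\<^sub>n a * (of_nat a ^ n * (\<Sum>k. l_term q F a (- of_nat n) k))"
      by (simp only: mult.assoc)
    finally show ?thesis unfolding T power_minus[of q a] by (simp only: mult_ac)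
  qed
  have "l_pq p q F (- of_nat n) chi =
      (1 + q) / (1 + q ^ F) * (\<Sum>a | a \<in> {1..F} \<and> \<not> p dvd a. \<chi>\<^sub>n a * (- q) ^ a * ?T a)"
    unfolding l_pq_def q_number_2
    by (rule arg_cong[of _ _ "\<lambda>S. (1 + q) / (1 + q ^ F) * S"], rule sum.cong[OF refl], rule tm) simp
  also have "(\<Sum>a | a \<in> {1..F} \<and> \<not> p dvd a. \<chi>\<^sub>n a * (- q) ^ a * ?T a) =
      (\<Sum>a=1..F. \<chi>\<^sub>n\<^sub>p a * (- q) ^ a * ?T a)"
    by (rule sum.mono_neutral_cong_left) auto
  finally show ?thesis
    using euler_gen_coeff[OF F(1) one_plus_power_nz[of F], of n \<chi>\<^sub>n\<^sub>p] by simp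
qed

lemma l_pq_neg_nat_euler:
  "l_pq p q F (- of_nat n) chi =
     euler_char_q n f\<^sub>n \<chi>\<^sub>n q - of_nat p ^ n * \<chi>\<^sub>n p * (q_number 2 q / q_number 2 (q ^ p)) *
       euler_char_q n f\<^sub>n \<chi>\<^sub>n (q ^ p)"
proof -
  have fF: "f\<^sub>n dvd F" using twist_conductor_dvd_lcm F by (meson dvd_trans lcm_least)
  then have of: "odd f\<^sub>n" using F(1) dvd_trans by blast
  have nz1: "1 + q \<noteq> 0" using one_plus_power_nz[of 1] by simp
  have nzp: "1 + (q ^ p) ^ k \<noteq> 0" for k using one_plus_power_nz[of "p * k"] by (simp add: power_mult)
  have E: "euler_char_q n f\<^sub>n \<chi>\<^sub>n q = fact n * ((1 + q) * fps_nth (euler_gen \<chi>\<^sub>n q f\<^sub>n) n)"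
    using euler_char_q_gen[OF dcharacter_psi of nz1 one_plus_power_nz n] by simp
  have Ep: "euler_char_q n f\<^sub>n \<chi>\<^sub>n (q ^ p) = fact n * ((1 + q ^ p) * fps_nth (euler_gen \<chi>\<^sub>n (q ^ p) f\<^sub>n) n)"
    using euler_char_q_gen[OF dcharacter_psi of one_plus_power_nz nzp n] by simp
  have split: "fps_nth (euler_gen \<chi>\<^sub>n\<^sub>p q F) n =
      fps_nth (euler_gen \<chi>\<^sub>n q f\<^sub>n) n - \<chi>\<^sub>n p * (of_nat p ^ n * fps_nth (euler_gen \<chi>\<^sub>n (q ^ p) f\<^sub>n) n)"
    unfolding euler_gen_remove_multiples[OF dcharacter_psi prime_p odd_p F(1,2) fF one_plus_power_nz]
    by (simp add: fps_compose_linear)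
  \<comment> \<open>The quotient of \<open>q\<close>-numbers exchanges the normalising factor
    \<open>1 + q ^ p\<close> of the second Euler number for \<open>1 + q\<close>.\<close>
  have c: "(1 + q) / (1 + q ^ p) * (fact n * ((1 + q ^ p) * B)) = fact n * ((1 + q) * B)" for B
    using one_plus_power_nz[of p] by simp
  show ?thesis
    unfolding l_pq_neg_nat E Ep q_number_2 fps_mult_left_const_nth split mult.assoc c
    by (simp only: right_diff_distrib mult_ac)
qed

lemma l_pq_integral:
  "has_integral_X_star d p q (\<lambda>x. \<chi>\<^sub>n (x 1) * X_to_Zp x ^ n) (l_pq p q F (- of_nat n) chi)"
proof -
  let ?L = "l_pq p q F (- of_nat n) chi"
  define R where "R N = 1 / q_number (d * p ^ N) (- q) *
    (\<Sum>x<d * p ^ N. (if X_of_nat d p x \<in> X_star d p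
        then \<chi>\<^sub>n (X_of_nat d p x 1) * X_to_Zp (X_of_nat d p x) ^ n else 0) * (- q) ^ x)" for N
  have d0: "d > 0" using chi by (simp add: primitive_dcharacter_def dcharacter_def)
  have p0: "p > 0" using p_ge_3 by simp
  have lim: "X_of_nat d p x \<in> X_lim d p" for x
    using d0 p0 by (auto simp: X_lim_def X_of_nat_def cong_def intro!: mod_mod_cancel)
  have fdp: "f\<^sub>n dvd d * p" using twist_conductor_dvd_lcm by (meson dvd_trans lcm_least dvd_triv_left dvd_triv_right)
  have integrand: "(if X_of_nat d p x \<in> X_star d p
        then \<chi>\<^sub>n (X_of_nat d p x 1) * X_to_Zp (X_of_nat d p x) ^ n else 0) = \<chi>\<^sub>n\<^sub>p x * of_nat x ^ n" for x
  proof -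
    have x1: "X_of_nat d p x 1 = x mod (d * p)" by (simp add: X_of_nat_def)
    have dv: "p dvd x mod (d * p) \<longleftrightarrow> p dvd x" by (simp add: dvd_mod_iff)
    have "X_of_nat d p x \<in> X_star d p \<longleftrightarrow> \<not> p dvd x"
    proof
      assume "X_of_nat d p x \<in> X_star d p"
      then have "coprime (x mod (d * p)) p" by (auto simp: X_star_def x1[unfolded One_nat_def])
      then show "\<not> p dvd x"
        using dv prime_p by (metis coprime_absorb_right not_prime_unit)
    next
      assume px: "\<not> p dvd x"
      then have "coprime (x mod (d * p)) p"
        using dv prime_p by (metis coprime_commute prime_imp_coprime)
      moreover have "x mod (d * p) > 0" using px dv by (metis dvd_0_right gr0I)
      moreover have "x mod (d * p) < d * p" using d0 p0 by simp
      ultimately show "X_of_nat d p x \<in> X_star d p"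
        using lim by (auto simp: X_star_def x1[unfolded One_nat_def])
    qed
    moreover have "\<chi>\<^sub>n (X_of_nat d p x 1) = \<chi>\<^sub>n x"
      unfolding x1 using fdp by (intro dcharacter_cong[OF dcharacter_psi]) (simp add: cong_def mod_mod_cancel)
    moreover have "X_to_Zp (X_of_nat d p x) = (of_nat x :: 'c)"
      unfolding X_to_Zp_def
    proof (rule limI, rule tendsto_eventually, unfold eventually_sequentially, intro exI allI impI)
      \<comment> \<open>The residues of a natural number are eventually constant:
        \<open>x \<le> N < p ^ N\<close>, so reduction modulo \<open>d * p ^ N\<close> leaves
        \<open>x\<close> unchanged.\<close>
      fix N assume "x \<le> N"
      have "N < p ^ N" using p_ge_3 by (intro less_exp[THEN less_le_trans] power_mono) auto
      also have "p ^ N \<le> d * p ^ N" using d0 by simp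
      finally show "of_nat (X_of_nat d p x N) = (of_nat x :: 'c)"
        using \<open>x \<le> N\<close> by (simp add: X_of_nat_def)
    qed
    ultimately show ?thesis by simp
  qed
  have bound: "vabs (R N - ?L) \<le> (1 / real p) ^ N" if N: "N \<ge> 1" for N
  proof -
    define M where "M = d * p ^ N"
    have oM: "odd M" using odd_d odd_p by (simp add: M_def)
    have "p dvd M" using N by (simp add: M_def dvd_power)
    have M0: "M > 0" using oM by (auto intro: Nat.gr0I)
    \<comment> \<open>Neither of \<open>F\<close> and \<open>M\<close> need divide the other, so
      their series are compared through this common period.\<close>
    define P where "P = lcm f\<^sub>n p"
    have "P dvd F" using twist_conductor_dvd_lcm F unfolding P_def by (meson dvd_trans lcm_least)
    then obtain r where r: "F = P * r" by blast
    have "d * p dvd M" using N by (simp add: M_def dvd_power)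
    then have "P dvd M" using fdp \<open>p dvd M\<close> unfolding P_def by (meson dvd_trans lcm_least)
    then obtain r' where r': "M = P * r'" by blast
    have per: "\<chi>\<^sub>n\<^sub>p (a + P) = \<chi>\<^sub>n\<^sub>p a" for a
    proof -
      have "[a + P = a] (mod f\<^sub>n)" "p dvd a + P \<longleftrightarrow> p dvd a"
        by (auto simp: P_def cong_def dvd_add_left_iff mod_eq_0_iff_dvd mod_add_right_eq[symmetric, of a "lcm f\<^sub>n p"])
      then show ?thesis using dcharacter_cong[OF dcharacter_psi] by auto
    qed
    have "euler_gen \<chi>\<^sub>n\<^sub>p q F = euler_gen \<chi>\<^sub>n\<^sub>p q P" "euler_gen \<chi>\<^sub>n\<^sub>p q M = euler_gen \<chi>\<^sub>n\<^sub>p q P"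
      using euler_gen_period[of \<chi>\<^sub>n\<^sub>p P r q] euler_gen_period[of \<chi>\<^sub>n\<^sub>p P r' q] per one_plus_power_nz F(1) oM r r'
      by auto
    then have "?L = fact n * fps_nth (fps_const (1 + q) * euler_gen \<chi>\<^sub>n\<^sub>p q M) n"
      by (simp only: l_pq_neg_nat)
    then have L: "?L = (1 + q) / (1 + q ^ M) * (\<Sum>a=1..M. \<chi>\<^sub>n\<^sub>p a * (- q) ^ a *
        (\<Sum>k\<le>n. of_nat (n choose k) * of_nat a ^ (n - k) * of_nat M ^ k * euler_q k (q ^ M)))"
      by (simp only: euler_gen_coeff[OF oM one_plus_power_nz])
    have "- q \<noteq> 1" using one_plus_power_nz[of 1] by (metis add.right_inverse power_one_right add.inverse_inverse)
    then have "1 / q_number M (- q) = (1 + q) / (1 + q ^ M)"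
      using oM by (simp add: q_number_def)
    \<comment> \<open>The Riemann sum runs from 0 to \<open>M - 1\<close>, the generating function
      from 1 to \<open>M\<close>. The summands at 0 and at \<open>M\<close> vanish, both being
      multiples of \<open>p\<close>.\<close>
    moreover have "(\<Sum>x<M. \<chi>\<^sub>n\<^sub>p x * of_nat x ^ n * (- q) ^ x) = (\<Sum>a=1..M. \<chi>\<^sub>n\<^sub>p a * of_nat a ^ n * (- q) ^ a)"
      using \<open>p dvd M\<close> by (intro sum.mono_neutral_cong) (auto simp: Suc_le_eq not_less dest: antisym)
    ultimately have R: "R N = (1 + q) / (1 + q ^ M) * (\<Sum>a=1..M. \<chi>\<^sub>n\<^sub>p a * of_nat a ^ n * (- q) ^ a)"
      unfolding R_def integrand M_def[symmetric] by simp
    let ?t = "\<lambda>a k. of_nat (n choose k) * of_nat a ^ (n - k) * of_nat M ^ k * euler_q k (q ^ M) :: 'c"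
    \<comment> \<open>The term \<open>k = 0\<close> is \<open>a ^ n\<close>, since the Euler number
      of index 0 is 1, and reproduces the Riemann sum. All others contain a factor \<open>M\<close>
      and so are at most \<open>(1 / p) ^ N\<close>.\<close>
    have split: "(\<Sum>k\<le>n. ?t a k) = of_nat a ^ n + (\<Sum>k=1..n. ?t a k)" for a
    proof -
      have "(\<Sum>k\<le>n. ?t a k) = ?t a 0 + (\<Sum>k\<in>{..n} - {0}. ?t a k)"
        by (rule sum.remove) auto
      moreover have "{..n} - {0} = {1..n}" by auto
      ultimately show ?thesis using euler_q_0[OF one_plus_power_nz[of M]] by simp
    qed
    have "?L - R N = (1 + q) / (1 + q ^ M) * (\<Sum>a=1..M. \<chi>\<^sub>n\<^sub>p a * (- q) ^ a * (\<Sum>k=1..n. ?t a k))"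
      unfolding L R right_diff_distrib[symmetric] sum_subtractf[symmetric] split
      by (intro arg_cong2[of _ _ _ _ "(*)"] refl sum.cong) (simp only: distrib_left mult_ac add_diff_cancel_left')
    moreover have vM: "vabs (of_nat M :: 'c) \<le> (1 / real p) ^ N"
      by (rule vabs_of_nat_dvd) (simp add: M_def)
    have tb: "vabs (?t a k) \<le> (1 / real p) ^ N" if "k \<in> {1..n}" for a k
    proof -
      have "vabs (of_nat M :: 'c) ^ k \<le> vabs (of_nat M :: 'c) ^ 1"
        using that vabs_of_nat_le_1[of M, where 'c='c] by (intro power_decreasing) (auto simp: vabs_nonneg)
      then have "vabs (of_nat M :: 'c) ^ k \<le> (1 / real p) ^ N" using vM by simp
      moreover have "vabs (euler_q k (q ^ M)) \<le> 1"
        using vabs_one_plus_power[OF q, of M] vabs_one_minus_power(1)[OF q]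
        by (intro vabs_euler_q_le_1) (auto simp: vabs_power)
      moreover have "vabs (of_nat (n choose k) * of_nat a ^ (n - k) :: 'c) \<le> 1"
        using vabs_of_nat_le_1[of "(n choose k) * a ^ (n - k)", where 'c='c] by simp
      ultimately have "vabs (of_nat (n choose k) * of_nat a ^ (n - k) :: 'c) * vabs (of_nat M :: 'c) ^ k *
          vabs (euler_q k (q ^ M)) \<le> 1 * (1 / real p) ^ N * 1"
        by (intro mult_mono) (auto simp: vabs_nonneg)
      then show ?thesis by (simp add: vabs_mult vabs_power)
    qed
    have "vabs (\<Sum>a=1..M. \<chi>\<^sub>n\<^sub>p a * (- q) ^ a * (\<Sum>k=1..n. ?t a k)) \<le> (1 / real p) ^ N"
    proof (rule vabs_sum_le)
      fix a
      have "vabs (\<Sum>k=1..n. ?t a k) \<le> (1 / real p) ^ N"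
        using tb by (intro vabs_sum_le) auto
      moreover have "vabs (\<chi>\<^sub>n\<^sub>p a) \<le> 1"
        using vabs_dcharacter_le_1[OF dcharacter_psi, of a] by simp
      ultimately have "vabs (\<chi>\<^sub>n\<^sub>p a) * vabs (\<Sum>k=1..n. ?t a k) \<le> 1 * (1 / real p) ^ N"
        by (intro mult_mono) (auto simp: vabs_nonneg)
      then show "vabs (\<chi>\<^sub>n\<^sub>p a * (- q) ^ a * (\<Sum>k=1..n. ?t a k)) \<le> (1 / real p) ^ N"
        using vabs_one_minus_power(1)[OF q] by (simp only: vabs_mult vabs_power vabs_minus power_one mult_1 mult_1_right)
    qed simp
    ultimately have "vabs (?L - R N) \<le> (1 / real p) ^ N"
      using vabs_one_plus_power[OF q, of 1] vabs_one_plus_power[OF q, of M]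
      by (simp only: vabs_mult vabs_divide power_one_right div_by_1 mult_1)
    then show ?thesis by (simp add: vabs_diff_commute)
  qed
  \<comment> \<open>The estimate was proved for \<open>N \<ge> 1\<close>, where \<open>p\<close>
    divides \<open>d * p ^ N\<close>; hence the shifted sequence.\<close>
  have "(\<lambda>N. (1 / real p) ^ Suc N) \<longlonglongrightarrow> 0"
    using p_ge_3 by (intro LIMSEQ_Suc LIMSEQ_power_zero) auto
  then have "(\<lambda>N. R (Suc N) - ?L) \<longlonglongrightarrow> 0"
    by (rule tendsto_0_vabs_le[rotated], intro bound) simp
  then have "(\<lambda>N. R (Suc N)) \<longlonglongrightarrow> ?L"
    by (simp add: tendsto_iff_vabs)
  then have "R \<longlonglongrightarrow> ?L" by (rule LIMSEQ_imp_Suc)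
  then show ?thesis
    unfolding has_integral_X_star_def has_integral_X_def R_def .
qed

end

text \<open>Since \<open>p\<close> divides \<open>F\<close> but not \<open>a\<close>, and the Euler
  numbers are integral, the coefficients of the binomial series are at most
  \<open>(1 / p) ^ k\<close>. Finite sums and products of analytic functions do the rest.\<close>

lemma l_pq_analytic:
  assumes q: "vabs (1 - q :: 'c) < 1" and F: "p dvd F"
  shows "\<not> p dvd a \<Longrightarrow> vabs s < real p / \<theta> \<Longrightarrow> summable (l_term q F a s)"
    and "analytic_on_disc (real p / \<theta>) (\<lambda>s. l_pq p q F s chi)"
proof -
  define b where "b a k = (of_nat F / of_nat a) ^ k * euler_q k (q ^ F)" for a k
  have b: "vabs (b a k) \<le> (1 / real p) ^ k" if a: "\<not> p dvd a" for a k
  proof -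
    have "vabs (euler_q k (q ^ F)) \<le> 1"
      using vabs_one_plus_power[OF q, of F] vabs_one_minus_power(1)[OF q]
      by (intro vabs_euler_q_le_1) (auto simp: vabs_power)
    moreover have "vabs (of_nat F :: 'c) ^ k \<le> (1 / real p) ^ k"
      using vabs_of_nat_dvd[of 1 F] F by (intro power_mono) (auto simp: vabs_nonneg)
    ultimately have "vabs (of_nat F :: 'c) ^ k * vabs (euler_q k (q ^ F)) \<le> (1 / real p) ^ k * 1"
      by (intro mult_mono) (auto simp: vabs_nonneg)
    then show ?thesis
      using vabs_of_nat_unit[OF a] by (simp add: b_def vabs_mult vabs_power vabs_divide)
  qed
  have lt: "l_term q F a s = (\<lambda>k. ((- s) gchoose k) * b a k)" for a s
    by (simp add: fun_eq_iff l_term_def b_def mult.assoc)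
  show "\<not> p dvd a \<Longrightarrow> vabs s < real p / \<theta> \<Longrightarrow> summable (l_term q F a s)"
    unfolding lt by (rule gbinomial_series_analytic(1)[OF b])
  show "analytic_on_disc (real p / \<theta>) (\<lambda>s. l_pq p q F s chi)"
    unfolding l_pq_def lt
    by (intro analytic_on_disc_cmult analytic_on_disc_sum analytic_on_disc_mult[of _ "\<lambda>s. _ * _ s"]
        analytic_one_unit_pow gbinomial_series_analytic(2) b) auto
qed

end

theorem theorem7:
  fixes p d F :: nat and q :: "'c::nonarch_field" and chi :: "nat \<Rightarrow> 'c"
  assumes "prime p" and "odd p" and "is_Cp p TYPE('c)"
    and "vabs (1 - q) < 1"
    and "primitive_dcharacter d chi" and "odd d"
    and "odd F" and "p dvd F" and "d dvd F"
  shows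
    "((\<forall>s a. vabs s < real p powr (1 - 1 / (real p - 1)) \<and> a \<in> {1..F} \<and> \<not> p dvd a \<longrightarrow>
         summable (l_term q F a s)) \<and>
      analytic_on_disc (real p powr (1 - 1 / (real p - 1))) (\<lambda>s. l_pq p q F s chi)) \<and>
     (\<forall>n::nat. n > 0 \<longrightarrow>
        l_pq p q F (- of_nat n) chi =
          euler_char_q n (twist_conductor p d chi n) (twist_char p d chi n) q
          - of_nat p ^ n * twist_char p d chi n p * (q_number 2 q / q_number 2 (q ^ p)) *
            euler_char_q n (twist_conductor p d chi n) (twist_char p d chi n) (q ^ p)) \<and>
     (\<forall>n::nat. n > 0 \<longrightarrow>
        has_integral_X_star d p q (\<lambda>x. twist_char p d chi n (x 1) * X_to_Zp x ^ n)
          (l_pq p q F (- of_nat n) chi))"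
proof -
  interpret padic_field p "TYPE('c)"
    using assms(1-3) by unfold_locales (auto simp: is_Cp_def)
  show ?thesis
    unfolding radius_eq
  proof (intro conjI allI impI)
    fix s :: 'c and a
    assume "vabs s < real p / \<theta> \<and> a \<in> {1..F} \<and> \<not> p dvd a"
    then show "summable (l_term q F a s)"
      by (intro l_pq_analytic(1)[OF assms(4,8)]) simp_all
  qed (rule l_pq_analytic(2)[OF assms(4,8)] l_pq_neg_nat_euler[OF assms(4-9)]
      l_pq_integral[OF assms(4-9)], assumption?)+
qed

end
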